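(* Let $f$ be a real-valued function on the segment $[a,b]$ and consider its optimization (minimization) on $[a,b]$ by expected improvement with the covariance function $G(x,x')=e^{-(x-x')^2/2}$; that is, let $x_1,x_2,\ldots\in[a,b]$ be a sequence such that $x_{n+1}$ is a maximizer of the expected improvement $\mathfrak I_n$ over $[a,b]$ for every $n\ge1$. Suppose that $f$ continues analytically to a complex domain $\mathcal D\supset[a,b]$ such that $\operatorname{dist}([a,b],\partial\mathcal D)>\rho>|b-a|$. Then $f_n^*=\min_{k=1,\ldots,n}f(x_k)$ converges to the global minimum $f^*=\min_{x\in[a,b]}f(x)$ of $f$ on $[a,b]$, and $$f_n^*-f^*=O\Big(\Big(\frac{b-a}{\rho}\Big)^n\Big),\qquad n\to\infty.$$
   Context: Optimization by expected improvement (EI). Let $\{\xi_x\}_{x\in[a,b]}$ be a centered Gaussian process with covariance $\mathsf E(\xi_x\xi_{x'})=G(x,x')=e^{-(x-x')^2/2}$. Given sampled points $x_1,\ldots,x_n\in[a,b]$ and values $f(x_1),\ldots,f(x_n)$, the current best result is $f_n^*=\min_{k=1,\ldots,n}f(x_k)$, and the expected improvement is $$\mathfrak I_n(x)=\mathsf E\big(f_n^*-\min(f_n^*,\xi_x)\,\big|\,\{\xi_{x_k}=f(x_k)\}_{k=1}^n\big),\qquad x\in[a,b].$$ Here the conditional law of $\xi_x$ given $\{\xi_{x_k}=f(x_k)\}_{k=1}^n$ is the usual Gaussian conditional law: for distinct nodes it is $\mathcal N(m_n(x),\sigma_n^2(x))$ with $m_n(x)=g^{T}A^{-1}y$ and $\sigma_n^2(x)=1-g^{T}A^{-1}g$,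 where $A=(e^{-(x_k-x_l)^2/2})_{k,l=1}^n$, $g=(e^{-(x-x_k)^2/2})_{k=1}^n$, $y=(f(x_k))_{k=1}^n$. The algorithm chooses $x_{n+1}=\arg\max_{x\in[a,b]}\mathfrak I_n(x)$, and it is assumed that this auxiliary optimization problem is solved exactly at each step. The initial point $x_1\in[a,b]$ is arbitrary. *)

theory Defs
  imports
    "HOL-Probability.Probability"
    "HOL-Complex_Analysis.Complex_Analysis"
    "HOL-Library.Landau_Symbols"
    "Jordan_Normal_Form.Gauss_Jordan_Elimination"
begin

definition gauss_cov :: "real \<Rightarrow> real \<Rightarrow> real" where
  "gauss_cov x x' = exp (- ((x - x')\<^sup>2) / 2)"

(* The sample x 1, ..., x n. Conditioning twice on the same event is the same as conditioning
   once, so repeated points are dropped; this keeps the covariance matrix invertible. For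
   distinct points the list is exactly [x 1, ..., x n]. The value x 0 is never used. *)
definition nodes :: "(nat \<Rightarrow> real) \<Rightarrow> nat \<Rightarrow> real list" where
  "nodes x n = remdups (map x [1..<Suc n])"

definition cov_mat :: "real list \<Rightarrow> real mat" where
  "cov_mat xs = mat (length xs) (length xs) (\<lambda>(k, l). gauss_cov (xs ! k) (xs ! l))"

definition cov_vec :: "real list \<Rightarrow> real \<Rightarrow> real vec" where
  "cov_vec xs t = vec (length xs) (\<lambda>k. gauss_cov t (xs ! k))"

(* The covariance matrix of distinct points is positive definite, so the inverse exists
   on every list produced by nodes. *)
definition cov_inv :: "real list \<Rightarrow> real mat" where
  "cov_inv xs = the (mat_inverse (cov_mat xs))"

definition cond_mean :: "(real \<Rightarrow> real) \<Rightarrow> real list \<Rightarrow> real \<Rightarrow> real" where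
  "cond_mean f xs t =
     scalar_prod (cov_vec xs t) (cov_inv xs *\<^sub>v vec (length xs) (\<lambda>k. f (xs ! k)))"

definition cond_var :: "real list \<Rightarrow> real \<Rightarrow> real" where
  "cond_var xs t = 1 - scalar_prod (cov_vec xs t) (cov_inv xs *\<^sub>v cov_vec xs t)"

(* The normal law N(m, v), as the law of m + sqrt v * Z with Z standard normal. Unlike
   normal_density, which vanishes identically for standard deviation 0, this yields the
   point mass at m when v = 0, as is needed at the sampled points. *)
definition normal_law :: "real \<Rightarrow> real \<Rightarrow> real measure" where
  "normal_law m v =
     distr (density lborel (\<lambda>z. ennreal (std_normal_density z))) borel (\<lambda>z. m + sqrt v * z)"

(* The law of the process at t, conditioned on having the values of f at the points of xs. *)
definition cond_law :: "(real \<Rightarrow> real) \<Rightarrow> real list \<Rightarrow> real \<Rightarrow> real measure" where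
  "cond_law f xs t = normal_law (cond_mean f xs t) (cond_var xs t)"

definition best_value :: "(real \<Rightarrow> real) \<Rightarrow> (nat \<Rightarrow> real) \<Rightarrow> nat \<Rightarrow> real" where
  "best_value f x n = Min ((\<lambda>k. f (x k)) ` {1..n})"

definition expected_improvement ::
    "(real \<Rightarrow> real) \<Rightarrow> (nat \<Rightarrow> real) \<Rightarrow> nat \<Rightarrow> real \<Rightarrow> real" where
  "expected_improvement f x n t =
     (\<integral>\<xi>. best_value f x n - min (best_value f x n) \<xi> \<partial>(cond_law f (nodes x n) t))"

definition EI_sequence :: "(real \<Rightarrow> real) \<Rightarrow> real \<Rightarrow> real \<Rightarrow> (nat \<Rightarrow> real) \<Rightarrow> bool" where
  "EI_sequence f a b x \<longleftrightarrow>
     x 1 \<in> {a..b} \<and>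
     (\<forall>n\<ge>1. is_arg_max (expected_improvement f x n) (\<lambda>t. t \<in> {a..b}) (x (Suc n)))"

(* The condition dist(S, boundary of D) > r. For D = UNIV the boundary is empty and the distance
   is infinite, whereas setdist S {} = 0. *)
definition boundary_dist_gt :: "complex set \<Rightarrow> complex set \<Rightarrow> real \<Rightarrow> bool" where
  "boundary_dist_gt S D r \<longleftrightarrow> frontier D = {} \<or> setdist S (frontier D) > r"

end

theory Submission
  imports Defs "Jordan_Normal_Form.Determinant"
begin

text \<open>
  Write \<open>L = b - a\<close> and \<open>q = L / \<rho>\<close>. Uniformly on the segment, the conditional standard deviation after
  \<open>n\<close> distinct samples is \<open>O(q\<^sup>n)\<close> (in fact it decays like \<open>L\<^sup>n / sqrt (n!)\<close>) and the conditional mean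
  is \<open>f + O(q\<^sup>n)\<close>. Expected improvement is at least the current best value minus the conditional mean,
  and at most the positive part of this difference plus a multiple of the standard deviation.
  Comparing a minimizer \<open>t\<^sub>0\<close> with the maximizer \<open>x\<^sub>n\<^sub>+\<^sub>1\<close> therefore gives
  \<open>f\<^sub>n\<^sup>* - f(t\<^sub>0) \<le> max 0 (f\<^sub>n\<^sup>* - f(x\<^sub>n\<^sub>+\<^sub>1)) + O(q\<^sup>n)\<close>; the first term on the right is
  \<open>f\<^sub>n\<^sup>* - f\<^sub>n\<^sub>+\<^sub>1\<^sup>*\<close>, so one further step already brings the error down to \<open>O(q\<^sup>n)\<close>.
  No point is sampled twice if \<open>a < b\<close>, because expected improvement vanishes at the samples
  and is positive elsewhere.
\<close>

section \<open>Polynomial interpolation\<close>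

text \<open>Rolle's theorem is applied on each gap between neighbouring zeros in sorted order. The
  gaps are disjoint open intervals, so the zeros found in them are distinct.\<close>

lemma rolle_zeros_step:
  fixes g g' :: "real \<Rightarrow> real"
  assumes g: "\<And>t. t \<in> {a..b} \<Longrightarrow> (g has_real_derivative g' t) (at t)"
    and Z: "finite Z" "Z \<subseteq> {a..b}" "card Z = Suc m" and g0: "\<And>z. z \<in> Z \<Longrightarrow> g z = 0"
  obtains Z' where "finite Z'" "Z' \<subseteq> {a..b}" "card Z' = m" "\<And>z. z \<in> Z' \<Longrightarrow> g' z = 0"
proof -
  define l where "l = sorted_list_of_set Z"
  have l: "sorted_wrt (<) l" "set l = Z" "length l = Suc m"
    using Z by (simp_all add: l_def)
  have lt: "l ! i < l ! j" if "i < j" "j < Suc m" for i j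
    using sorted_wrt_nth_less[OF l(1)] that l(3) by simp
  have lZ: "l ! i \<in> Z" if "i < Suc m" for i using that l by (metis nth_mem)
  have "\<exists>\<xi>. l ! i < \<xi> \<and> \<xi> < l ! Suc i \<and> g' \<xi> = 0" if i: "i < m" for i
  proof -
    have sub: "{l ! i..l ! Suc i} \<subseteq> {a..b}"
      using lZ[of i] lZ[of "Suc i"] i Z(2) by fastforce
    have "\<exists>\<xi>. l ! i < \<xi> \<and> \<xi> < l ! Suc i \<and> (\<lambda>h. g' \<xi> * h) = (\<lambda>v. 0)"
    proof (rule Rolle_deriv)
      show "l ! i < l ! Suc i" using lt i by simp
      show "g (l ! i) = g (l ! Suc i)" using g0 lZ i by simp
      show "continuous_on {l ! i..l ! Suc i} g"
        by (intro DERIV_continuous_on[where D = g']) (use g sub has_field_derivative_at_within in blast)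
      show "(g has_derivative (\<lambda>h. g' t * h)) (at t)" if "l ! i < t" "t < l ! Suc i" for t
        using g[of t] sub that by (auto simp: has_field_derivative_def subset_iff)
    qed
    then show ?thesis by (metis mult_1_right)
  qed
  then obtain \<xi> where \<xi>: "\<And>i. i < m \<Longrightarrow> l ! i < \<xi> i \<and> \<xi> i < l ! Suc i \<and> g' (\<xi> i) = 0" by metis
  have mono: "\<xi> i < \<xi> j" if "i < j" "j < m" for i j
  proof -
    have "l ! Suc i \<le> l ! j" using lt[of "Suc i" j] that by (cases "Suc i = j") auto
    then show ?thesis using \<xi>[of i] \<xi>[of j] that by simp
  qed
  have inj: "inj_on \<xi> {..<m}"
    by (rule inj_onI) (metis lessThan_iff less_irrefl linorder_neqE_nat mono)
  show thesis
  proof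
    show "finite (\<xi> ` {..<m})" by simp
    show "\<xi> ` {..<m} \<subseteq> {a..b}"
    proof safe
      fix i assume "i < m"
      then have "l ! i \<in> {a..b}" "l ! Suc i \<in> {a..b}" using lZ[of i] lZ[of "Suc i"] Z(2) by auto
      then show "\<xi> i \<in> {a..b}" using \<xi>[OF \<open>i < m\<close>] by simp
    qed
    show "card (\<xi> ` {..<m}) = m" using inj by (simp add: card_image)
    show "g' z = 0" if "z \<in> \<xi> ` {..<m}" for z using that \<xi> by auto
  qed
qed

text \<open>The family \<open>U\<close> encodes a smooth function together with its successive
  derivatives, so a derivative is handled by shifting the index.\<close>

lemma rolle_zeros:
  fixes U :: "nat \<Rightarrow> real \<Rightarrow> real"
  assumes U: "\<And>k t. t \<in> {a..b} \<Longrightarrow> (U k has_real_derivative U (Suc k) t) (at t)"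
    and "finite Z" "Z \<subseteq> {a..b}" "card Z = m + j" "\<And>z. z \<in> Z \<Longrightarrow> U 0 z = 0"
  shows "\<exists>Z'. finite Z' \<and> Z' \<subseteq> {a..b} \<and> card Z' = m \<and> (\<forall>z\<in>Z'. U j z = 0)"
  using assms(4)
proof (induction j arbitrary: m)
  case 0
  then show ?case using assms by auto
next
  case (Suc j)
  from Suc.IH[of "Suc m"] Suc.prems obtain Z1 where
    "finite Z1" "Z1 \<subseteq> {a..b}" "card Z1 = Suc m" "\<forall>z\<in>Z1. U j z = 0" by auto
  then show ?case using rolle_zeros_step[of a b "U j" "U (Suc j)" Z1 m] U by metis
qed

text \<open>The product is monic of degree \<open>card Z\<close>, so only its leading term survives
  that many derivatives.\<close>

lemma pderiv_funpow_monic_linear_prod: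
  fixes Z :: "real set"
  assumes "finite Z"
  shows "(pderiv ^^ card Z) (\<Prod>z\<in>Z. [:- z, 1:]) = [:fact (card Z):]"
proof -
  let ?p = "\<Prod>z\<in>Z. [:- z, 1:]"
  have deg: "degree ?p = card Z" by (simp add: degree_prod_eq_sum_degree)
  have lead: "lead_coeff ?p = 1" by (simp add: lead_coeff_prod)
  have "coeff ((pderiv ^^ card Z) ?p) i = coeff [:fact (card Z):] i" for i
  proof (cases i)
    case 0
    then show ?thesis using lead deg
      by (simp add: coeff_higher_pderiv pochhammer_fact)
  next
    case (Suc i')
    have "degree ?p < i + card Z" using deg Suc by simp
    then show ?thesis using Suc by (simp add: coeff_higher_pderiv coeff_eq_0 del: add_Suc add_Suc_right)
  qed
  then show ?thesis by (rule poly_eqI)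
qed

lemma poly_funpow_pderiv_DERIV:
  "(poly ((pderiv ^^ k) p) has_real_derivative poly ((pderiv ^^ Suc k) p) t) (at t)"
  by (simp add: poly_DERIV)

text \<open>The classical remainder argument: a multiple \<open>K\<close> of the nodal polynomial is
  subtracted so that the difference also vanishes at \<open>t\<close>. It then has
  \<open>m + 1\<close> zeros, so its derivative of order \<open>m\<close> has a zero
  \<open>s\<close>, and this identifies \<open>K\<close> as \<open>U m s / fact m\<close>.\<close>

lemma interpolation_error_zeros:
  fixes U :: "nat \<Rightarrow> real \<Rightarrow> real"
  assumes U: "\<And>k t. t \<in> {a..b} \<Longrightarrow> (U k has_real_derivative U (Suc k) t) (at t)"
    and Z: "finite Z" "Z \<subseteq> {a..b}" "card Z = m" "\<And>z. z \<in> Z \<Longrightarrow> U 0 z = 0"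
    and B: "\<And>t. t \<in> {a..b} \<Longrightarrow> \<bar>U m t\<bar> \<le> B" and t: "t \<in> {a..b}"
  shows "\<bar>U 0 t\<bar> \<le> B * (b - a) ^ m / fact m"
proof (cases "t \<in> Z")
  case True
  have "B \<ge> 0" using B[OF t] by linarith
  then show ?thesis using True Z t by simp
next
  case False
  define p where "p = (\<Prod>z\<in>Z. [:- z, 1:])"
  have pt: "poly p t \<noteq> 0" using False Z(1) by (simp add: p_def poly_prod)
  define K where "K = U 0 t / poly p t"
  define W where "W = (\<lambda>k s. U k s - K * poly ((pderiv ^^ k) p) s)"
  have "\<exists>Z'. finite Z' \<and> Z' \<subseteq> {a..b} \<and> card Z' = 1 \<and> (\<forall>z\<in>Z'. W m z = 0)"
  proof (rule rolle_zeros)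
    show "(W k has_real_derivative W (Suc k) s) (at s)" if "s \<in> {a..b}" for k s
      unfolding W_def by (intro DERIV_diff DERIV_cmult U that poly_funpow_pderiv_DERIV)
    show "finite (insert t Z)" "insert t Z \<subseteq> {a..b}" "card (insert t Z) = 1 + m"
      using Z t False by auto
    show "W 0 z = 0" if "z \<in> insert t Z" for z
      using that Z(1,4) pt by (auto simp: W_def K_def p_def poly_prod)
  qed
  then obtain s where s: "s \<in> {a..b}" "W m s = 0" by (metis card_1_singletonE insert_subset singletonI)
  have "(pderiv ^^ m) p = [:fact m:]"
    using pderiv_funpow_monic_linear_prod[OF Z(1)] Z(3) by (simp add: p_def)
  with s(2) have Us: "U m s = K * fact m" by (simp add: W_def)
  have "\<bar>poly p t\<bar> = (\<Prod>z\<in>Z. \<bar>t - z\<bar>)" by (simp add: p_def poly_prod abs_prod)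
  also have "\<dots> \<le> (\<Prod>z\<in>Z. b - a)" using Z(2) t by (intro prod_mono) (auto simp: abs_le_iff)
  finally have pb: "\<bar>poly p t\<bar> \<le> (b - a) ^ m" using Z(3) by simp
  have "\<bar>U 0 t\<bar> = \<bar>K\<bar> * \<bar>poly p t\<bar>" using pt by (simp add: K_def)
  also have "\<bar>K\<bar> = \<bar>U m s\<bar> / fact m" using Us by (simp add: abs_mult)
  also have "\<dots> * \<bar>poly p t\<bar> \<le> B / fact m * (b - a) ^ m"
    using B[OF s(1)] pb by (intro mult_mono divide_right_mono) auto
  finally show ?thesis by simp
qed

text \<open>By Rolle, \<open>U j\<close> retains \<open>n - j\<close> zeros, and the previous
  estimate applies to the family shifted by \<open>j\<close>.\<close>

lemma interpolation_error_deriv: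
  fixes U :: "nat \<Rightarrow> real \<Rightarrow> real"
  assumes U: "\<And>k t. t \<in> {a..b} \<Longrightarrow> (U k has_real_derivative U (Suc k) t) (at t)"
    and Z: "finite Z" "Z \<subseteq> {a..b}" "card Z = n" "\<And>z. z \<in> Z \<Longrightarrow> U 0 z = 0"
    and B: "\<And>t. t \<in> {a..b} \<Longrightarrow> \<bar>U n t\<bar> \<le> B" and t: "t \<in> {a..b}" and j: "j \<le> n"
  shows "\<bar>U j t\<bar> \<le> B * (b - a) ^ (n - j) / fact (n - j)"
proof -
  obtain Z' where Z': "finite Z'" "Z' \<subseteq> {a..b}" "card Z' = n - j" "\<forall>z\<in>Z'. U j z = 0"
    using rolle_zeros[of a b U Z "n - j" j] U Z j by auto
  have "\<bar>U (0 + j) t\<bar> \<le> B * (b - a) ^ (n - j) / fact (n - j)"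
    by (rule interpolation_error_zeros[where U = "\<lambda>k. U (k + j)"]) (use U Z' B t j in auto)
  then show ?thesis by simp
qed

section \<open>Lagrange interpolants and their error, including derivatives\<close>

definition lagrange_poly :: "(nat \<Rightarrow> real) \<Rightarrow> nat \<Rightarrow> nat \<Rightarrow> real poly" where
  "lagrange_poly z n k = (\<Prod>l\<in>{..<n} - {k}. Polynomial.smult (1 / (z k - z l)) [:- z l, 1:])"

lemma poly_lagrange_poly_nodes:
  assumes "inj_on z {..<n}" "k < n" "l < n"
  shows "poly (lagrange_poly z n k) (z l) = (if k = l then 1 else 0)"
proof (cases "k = l")
  case True
  have "z l \<noteq> z i" if "i \<in> {..<n} - {l}" for i
    using assms that by (metis DiffD1 DiffD2 inj_onD lessThan_iff singletonI)
  then have "1 / (z l - z i) * (z l - z i) = 1" if "i \<in> {..<n} - {l}" for i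
    using that by simp
  then show ?thesis using True
    by (auto simp: lagrange_poly_def poly_prod simp del: smult_pCons intro!: prod.neutral)
next
  case False
  then show ?thesis using assms by (auto simp: lagrange_poly_def poly_prod intro!: prod_zero)
qed

lemma degree_lagrange_poly:
  assumes "k < n"
  shows "degree (lagrange_poly z n k) < n"
proof -
  have "degree (lagrange_poly z n k) \<le> (\<Sum>l\<in>{..<n} - {k}. degree (Polynomial.smult (1 / (z k - z l)) [:- z l, 1:]))"
    unfolding lagrange_poly_def 
    by (rule degree_prod_sum_le[unfolded comp_def]) simp
  also have "\<dots> \<le> (\<Sum>l\<in>{..<n} - {k}. 1)"
    by (intro sum_mono) (simp del: smult_pCons)
  also have "\<dots> < n" using assms by simp
  finally show ?thesis .
qed

definition interp_poly :: "(nat \<Rightarrow> real) \<Rightarrow> nat \<Rightarrow> (real \<Rightarrow> real) \<Rightarrow> real poly" where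
  "interp_poly z n h = (\<Sum>k<n. Polynomial.smult (h (z k)) (lagrange_poly z n k))"

lemma poly_interp_poly_nodes:
  assumes "inj_on z {..<n}" "l < n"
  shows "poly (interp_poly z n h) (z l) = h (z l)"
proof -
  have "poly (interp_poly z n h) (z l) = (\<Sum>k<n. h (z k) * (if k = l then 1 else 0))"
    unfolding interp_poly_def poly_sum poly_smult
    by (intro sum.cong refl) (use assms in \<open>simp add: poly_lagrange_poly_nodes\<close>)
  also have "\<dots> = h (z l)" using assms(2) by (simp add: sum.delta' if_distrib cong: if_cong)
  finally show ?thesis .
qed

text \<open>The second alternative covers \<open>n = 0\<close>, where no degree is below
  \<open>n\<close>.\<close>

lemma degree_interp_poly: "degree (interp_poly z n h) < n \<or> interp_poly z n h = 0"
proof (cases "n = 0")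
  case False
  then show ?thesis unfolding interp_poly_def
    by (intro disjI1 degree_sum_less) (auto intro: le_less_trans[OF degree_smult_le] degree_lagrange_poly)
qed (simp add: interp_poly_def)

lemma pderiv_interp_poly: "(pderiv ^^ n) (interp_poly z n h) = 0"
  using degree_interp_poly[of z n h] by (auto simp: poly_eq_iff coeff_higher_pderiv coeff_eq_0)

text \<open>The error vanishes at the nodes, and its derivative of order \<open>n\<close> is
  \<open>U n\<close> because the interpolant has degree below \<open>n\<close>. The case of positive
  \<open>j\<close> later controls the coefficients of the interpolant.\<close>

lemma interp_poly_error:
  fixes U :: "nat \<Rightarrow> real \<Rightarrow> real"
  assumes U: "\<And>k t. t \<in> {a..b} \<Longrightarrow> (U k has_real_derivative U (Suc k) t) (at t)"
    and z: "inj_on z {..<n}" "z ` {..<n} \<subseteq> {a..b}"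
    and B: "\<And>t. t \<in> {a..b} \<Longrightarrow> \<bar>U n t\<bar> \<le> B" and t: "t \<in> {a..b}" and j: "j \<le> n"
  shows "\<bar>U j t - poly ((pderiv ^^ j) (interp_poly z n (U 0))) t\<bar> \<le> B * (b - a) ^ (n - j) / fact (n - j)"
proof (rule interpolation_error_deriv[where U = "\<lambda>j t. U j t - poly ((pderiv ^^ j) (interp_poly z n (U 0))) t"])
  show "finite (z ` {..<n})" "z ` {..<n} \<subseteq> {a..b}" "card (z ` {..<n}) = n"
    using z by (auto simp: card_image)
  show "U 0 y - poly ((pderiv ^^ 0) (interp_poly z n (U 0))) y = 0" if "y \<in> z ` {..<n}" for y
    using that z(1) by (auto simp: poly_interp_poly_nodes)
  show "\<bar>U n s - poly ((pderiv ^^ n) (interp_poly z n (U 0))) s\<bar> \<le> B" if "s \<in> {a..b}" for s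
    using B[OF that] by (simp add: pderiv_interp_poly)
qed (use t j in \<open>auto intro!: DERIV_diff U poly_funpow_pderiv_DERIV simp del: funpow.simps\<close>)

section \<open>Kriging functionals for the Gaussian covariance\<close>

lemma gauss_cov_commute: "gauss_cov x y = gauss_cov y x"
  by (simp add: gauss_cov_def power2_commute)

lemma gauss_cov_self: "gauss_cov x x = 1"
  by (simp add: gauss_cov_def)

text \<open>The covariance equals \<open>exp (- x^2 / 2) * exp (- y^2 / 2) * exp (x * y)\<close>;
  the last factor is expanded in its exponential series.\<close>

lemma gauss_cov_sums:
  "(\<lambda>j. (exp (- x\<^sup>2 / 2) * x ^ j) * (exp (- y\<^sup>2 / 2) * y ^ j) / fact j) sums gauss_cov x y"
proof -
  have "(\<lambda>j. exp (- x\<^sup>2 / 2) * exp (- y\<^sup>2 / 2) * ((x * y) ^ j /\<^sub>R fact j)) sums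
      (exp (- x\<^sup>2 / 2) * exp (- y\<^sup>2 / 2) * exp (x * y))"
    by (intro sums_mult exp_converges)
  moreover have "exp (- x\<^sup>2 / 2) * exp (- y\<^sup>2 / 2) * exp (x * y) = gauss_cov x y"
    by (simp add: gauss_cov_def power2_eq_square field_simps flip: exp_add)
  ultimately show ?thesis by (simp add: power_mult_distrib field_simps)
qed

text \<open>The covariance factors through the feature map sending \<open>x\<close> to the sequence
  \<open>exp (- x\<^sup>2 / 2) x\<^sup>j / sqrt (j!)\<close>, so functionals on the process are analysed through
  their moments, the values on \<open>exp (- x\<^sup>2 / 2) x\<^sup>j\<close>.\<close>

definition moment :: "(nat \<Rightarrow> real) \<Rightarrow> nat \<Rightarrow> (nat \<Rightarrow> real) \<Rightarrow> nat \<Rightarrow> real" where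
  "moment z n c j = (\<Sum>k<n. c k * (exp (- (z k)\<^sup>2 / 2) * z k ^ j))"

definition cov_form :: "(nat \<Rightarrow> real) \<Rightarrow> nat \<Rightarrow> (nat \<Rightarrow> real) \<Rightarrow> real" where
  "cov_form z n c = (\<Sum>k<n. \<Sum>l<n. c k * c l * gauss_cov (z k) (z l))"

lemma moment_poly:
  assumes "degree p < N"
  shows "(\<Sum>j<N. coeff p j * moment z n c j) = (\<Sum>k<n. c k * (exp (- (z k)\<^sup>2 / 2) * poly p (z k)))"
proof -
  have "poly p x = (\<Sum>j<N. coeff p j * x ^ j)" for x
    unfolding poly_altdef using assms by (intro sum.mono_neutral_left) (auto simp: coeff_eq_0)
  then show ?thesis unfolding moment_def sum_distrib_left
    by (subst sum.swap) (simp add: sum_distrib_left sum_distrib_right mult_ac)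
qed

text \<open>Inserting the series for the covariance turns the quadratic form into the squared length
  of a combination of feature vectors, which makes its sign visible.\<close>

lemma cov_form_sums: "(\<lambda>j. (moment z n c j)\<^sup>2 / fact j) sums cov_form z n c"
proof -
  have "(\<lambda>j. \<Sum>k<n. \<Sum>l<n. c k * c l *
      ((exp (- (z k)\<^sup>2 / 2) * z k ^ j) * (exp (- (z l)\<^sup>2 / 2) * z l ^ j) / fact j)) sums cov_form z n c"
    unfolding cov_form_def by (intro sums_sum sums_mult gauss_cov_sums)
  then show ?thesis
    by (simp add: moment_def power2_eq_square sum_product sum_divide_distrib mult_ac)
qed

lemma cov_form_nonneg: "cov_form z n c \<ge> 0"
  using sums_le[OF _ sums_zero cov_form_sums, of z n c] by simp

lemma cov_form_eq_0_moment:
  assumes "cov_form z n c = 0" shows "moment z n c j = 0"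
proof -
  have "(moment z n c j)\<^sup>2 / fact j \<le> cov_form z n c"
    using sum_le_suminf[OF sums_summable[OF cov_form_sums[of z n c]], of "{j}"]
    by (simp add: sums_unique[OF cov_form_sums, symmetric])
  then have "(moment z n c j)\<^sup>2 \<le> 0" using assms
    by (simp add: divide_le_0_iff) (metis fact_gt_zero not_le)
  then show ?thesis by simp
qed

text \<open>If the form is zero, all moments vanish, so the functional annihilates the Gaussian
  factor times any polynomial. A Lagrange polynomial then isolates the single weight
  \<open>c k\<close>.\<close>

lemma cov_form_pos_def:
  assumes z: "inj_on z {..<n}" and 0: "cov_form z n c = 0" and k: "k < n"
  shows "c k = 0"
proof -
  have "0 = (\<Sum>j<n. coeff (lagrange_poly z n k) j * moment z n c j)"
    by (simp add: cov_form_eq_0_moment[OF 0])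
  also have "\<dots> = (\<Sum>l<n. c l * (exp (- (z l)\<^sup>2 / 2) * poly (lagrange_poly z n k) (z l)))"
    by (rule moment_poly) (rule degree_lagrange_poly[OF k])
  also have "\<dots> = (\<Sum>l<n. if l = k then c k * exp (- (z k)\<^sup>2 / 2) else 0)"
    by (intro sum.cong refl) (use z k in \<open>auto simp: poly_lagrange_poly_nodes\<close>)
  also have "\<dots> = c k * exp (- (z k)\<^sup>2 / 2)" using k by simp
  finally show ?thesis by simp
qed

text \<open>The error of the linear predictor with weights \<open>c\<close> for the value at
  \<open>t\<close>, tested on the Gaussian-weighted monomial of degree \<open>j\<close>.\<close>

definition feature_err :: "(nat \<Rightarrow> real) \<Rightarrow> nat \<Rightarrow> (nat \<Rightarrow> real) \<Rightarrow> real \<Rightarrow> nat \<Rightarrow> real" where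
  "feature_err z n c t j = exp (- t\<^sup>2 / 2) * t ^ j - moment z n c j"

lemma feature_err_poly:
  assumes "degree p < N"
  shows "(\<Sum>j<N. coeff p j * feature_err z n c t j) =
    exp (- t\<^sup>2 / 2) * poly p t - (\<Sum>k<n. c k * (exp (- (z k)\<^sup>2 / 2) * poly p (z k)))"
proof -
  have "poly p t = (\<Sum>j<N. coeff p j * t ^ j)"
    unfolding poly_altdef using assms by (intro sum.mono_neutral_left) (auto simp: coeff_eq_0)
  then show ?thesis
    by (simp add: feature_err_def right_diff_distrib sum_subtractf moment_poly[OF assms] sum_distrib_left sum_distrib_right mult_ac)
qed

text \<open>The prediction error is itself a combination of point values: \<open>t\<close> is
  adjoined as a further node with weight 1 and the old weights change sign. Facts on
  \<open>moment\<close> and \<open>cov_form\<close> thus transfer to it.\<close>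

lemma moment_extend: "moment (z(n := t)) (Suc n) ((\<lambda>k. - c k)(n := 1)) j = feature_err z n c t j"
  by (simp add: moment_def feature_err_def sum_negf)

lemma cov_form_extend:
  "cov_form (z(n := t)) (Suc n) ((\<lambda>k. - c k)(n := 1)) =
     1 - 2 * (\<Sum>k<n. c k * gauss_cov t (z k)) + cov_form z n c"
  by (simp add: cov_form_def sum.distrib sum_negf sum_subtractf gauss_cov_self gauss_cov_commute[of t])

text \<open>The sum of the series is the mean squared error of the predictor, for arbitrary weights
  \<open>c\<close>.\<close>

lemma feature_err_sums:
  "(\<lambda>j. (feature_err z n c t j)\<^sup>2 / fact j) sums (1 - 2 * (\<Sum>k<n. c k * gauss_cov t (z k)) + cov_form z n c)"
  using cov_form_sums[of "z(n := t)" "Suc n" "(\<lambda>k. - c k)(n := 1)"]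
  by (simp add: moment_extend cov_form_extend)

text \<open>The equations for \<open>c\<close> are the normal equations: the prediction error is
  uncorrelated with every sample. Under them the mean squared error simplifies to \<open>V\<close>,
  the conditional variance at \<open>t\<close>.\<close>

locale kriging =
  fixes z :: "nat \<Rightarrow> real" and n :: nat and c :: "nat \<Rightarrow> real" and t :: real
  assumes inj: "inj_on z {..<n}"
    and weights: "k < n \<Longrightarrow> (\<Sum>l<n. c l * gauss_cov (z k) (z l)) = gauss_cov t (z k)"
begin

definition V :: real where "V = 1 - (\<Sum>k<n. c k * gauss_cov t (z k))"

lemma cov_form_weights: "cov_form z n c = (\<Sum>k<n. c k * gauss_cov t (z k))"
  unfolding cov_form_def by (intro sum.cong refl) (simp add: weights mult.assoc flip: sum_distrib_left)

lemma feature_err_sums_V: "(\<lambda>j. (feature_err z n c t j)\<^sup>2 / fact j) sums V"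
  using feature_err_sums[of z n c t] by (simp add: cov_form_weights V_def)

lemma V_nonneg: "V \<ge> 0"
  using sums_le[OF _ sums_zero feature_err_sums_V] by simp

text \<open>Optimality of the kriging weights: the right side exceeds \<open>V\<close> by exactly
  \<open>cov_form\<close> of \<open>c - d\<close>, which is nonnegative.\<close>

lemma V_le: "V \<le> 1 - 2 * (\<Sum>k<n. d k * gauss_cov t (z k)) + cov_form z n d"
proof -
  have cross: "(\<Sum>k<n. \<Sum>l<n. d k * c l * gauss_cov (z k) (z l)) = (\<Sum>k<n. d k * gauss_cov t (z k))"
    by (intro sum.cong refl) (simp add: weights mult.assoc flip: sum_distrib_left)
  have "(\<Sum>k<n. \<Sum>l<n. c k * d l * gauss_cov (z k) (z l)) =
      (\<Sum>k<n. \<Sum>l<n. d k * c l * gauss_cov (z k) (z l))"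
    by (subst sum.swap) (simp add: gauss_cov_commute mult.commute)
  moreover have "cov_form z n (\<lambda>k. c k - d k) = cov_form z n c + cov_form z n d
      - (\<Sum>k<n. \<Sum>l<n. c k * d l * gauss_cov (z k) (z l)) - (\<Sum>k<n. \<Sum>l<n. d k * c l * gauss_cov (z k) (z l))"
    by (simp add: cov_form_def left_diff_distrib right_diff_distrib sum_subtractf)
  ultimately have "cov_form z n (\<lambda>k. c k - d k) =
      cov_form z n c + cov_form z n d - 2 * (\<Sum>k<n. d k * gauss_cov t (z k))"
    by (simp add: cross)
  then show ?thesis using cov_form_nonneg[of z n "\<lambda>k. c k - d k"] by (simp add: cov_form_weights V_def)
qed

text \<open>The weights concentrated at the node predict without error, so optimality forces the
  variance down to zero.\<close>

lemma V_node:
  assumes "k < n" "t = z k" shows "V = 0"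
proof -
  let ?d = "\<lambda>l. if l = k then 1 else 0 :: real"
  have delta: "(\<Sum>l<n. ?d l * g l) = g k" for g
  proof -
    have "(\<Sum>l<n. ?d l * g l) = (\<Sum>l<n. if l = k then g l else 0)" by (intro sum.cong) auto
    then show ?thesis using assms(1) by simp
  qed
  have "cov_form z n ?d = (\<Sum>i<n. ?d i * (\<Sum>l<n. ?d l * gauss_cov (z i) (z l)))"
    unfolding cov_form_def by (simp only: sum_distrib_left mult.assoc)
  then have "V \<le> 0" using V_le[of ?d] assms(2) by (simp only: delta gauss_cov_self)
  then show ?thesis using V_nonneg by simp
qed

text \<open>Zero variance would be a zero of the form on the distinct nodes \<open>z\<close> and
  \<open>t\<close>, although the weight at \<open>t\<close> is 1.\<close>

lemma V_pos:
  assumes "t \<notin> z ` {..<n}" shows "V > 0"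
proof (rule ccontr)
  assume "\<not> V > 0"
  then have "cov_form (z(n := t)) (Suc n) ((\<lambda>k. - c k)(n := 1)) = 0"
    using V_nonneg by (simp add: cov_form_extend cov_form_weights V_def)
  moreover have "inj_on (z(n := t)) {..<Suc n}"
    using inj assms by (auto simp: inj_on_def less_Suc_eq)
  ultimately have "((\<lambda>k. - c k)(n := 1)) n = 0" using cov_form_pos_def by blast
  then show False by simp
qed

text \<open>Cauchy--Schwarz with the factor \<open>sqrt (fact j)\<close> split off. The sum on the
  right is the squared reproducing kernel norm of the Gaussian factor times
  \<open>p\<close>.\<close>

lemma feature_err_poly_le:
  assumes "degree p < n \<or> p = 0"
  shows "(exp (- t\<^sup>2 / 2) * poly p t - (\<Sum>k<n. c k * (exp (- (z k)\<^sup>2 / 2) * poly p (z k))))\<^sup>2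
    \<le> V * (\<Sum>j<n. fact j * (coeff p j)\<^sup>2)"
proof (cases "p = 0")
  case False
  let ?e = "feature_err z n c t"
  have "(\<Sum>j<n. coeff p j * ?e j)\<^sup>2 =
      (\<Sum>j<n. (sqrt (fact j) * coeff p j) * (?e j / sqrt (fact j)))\<^sup>2" by simp
  also have "\<dots> \<le> (\<Sum>j<n. (sqrt (fact j) * coeff p j)\<^sup>2) * (\<Sum>j<n. (?e j / sqrt (fact j))\<^sup>2)"
    by (rule Cauchy_Schwarz_ineq_sum)
  also have "\<dots> = (\<Sum>j<n. fact j * (coeff p j)\<^sup>2) * (\<Sum>j<n. (?e j)\<^sup>2 / fact j)"
    by (simp add: power_mult_distrib power_divide)
  also have "\<dots> \<le> (\<Sum>j<n. fact j * (coeff p j)\<^sup>2) * V"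
  proof (intro mult_left_mono sum_nonneg)
    show "(\<Sum>j<n. (?e j)\<^sup>2 / fact j) \<le> V"
      using sum_le_suminf[OF sums_summable[OF feature_err_sums_V], of "{..<n}"]
      by (simp add: sums_unique[OF feature_err_sums_V, symmetric])
  qed simp
  finally show ?thesis using assms False by (simp add: feature_err_poly mult.commute)
qed (simp add: V_nonneg sum_nonneg)

end

text \<open>A single term of the expansion of \<open>(1 + \<delta>) ^ (n + m)\<close>. The base in
  \<open>n\<close> can be kept near 1; the possibly large base in \<open>m\<close> is later absorbed
  by \<open>1 / fact m\<close>.\<close>

lemma binomial_le_geometric:
  fixes \<delta> :: real
  assumes "\<delta> > 0"
  shows "real ((n + m) choose m) \<le> (1 + \<delta>) ^ n * ((1 + \<delta>) / \<delta>) ^ m"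
proof -
  have "real ((n + m) choose m) * \<delta> ^ m \<le> (\<Sum>k\<le>n + m. real ((n + m) choose k) * \<delta> ^ k)"
    by (rule member_le_sum) (use assms in auto)
  also have "\<dots> = (1 + \<delta>) ^ (n + m)"
    using binomial_ring[of \<delta> 1 "n + m"] by (simp add: add.commute)
  finally show ?thesis using assms by (simp add: field_simps power_add power_divide)
qed

lemma binomial_le_geometric':
  fixes \<delta> :: real
  assumes "\<delta> > 0"
  shows "real (n choose m) \<le> (1 + \<delta>) ^ n * (1 / \<delta>) ^ m"
proof (cases "m \<le> n")
  case True
  have "real (n choose m) \<le> (1 + \<delta>) ^ (n - m) * ((1 + \<delta>) / \<delta>) ^ m"
    using binomial_le_geometric[OF assms, of "n - m" m] True by simp
  also have "\<dots> = (1 + \<delta>) ^ (n - m) * (1 + \<delta>) ^ m * (1 / \<delta>) ^ m"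
    by (simp add: power_divide)
  also have "\<dots> = (1 + \<delta>) ^ n * (1 / \<delta>) ^ m" using True by (simp flip: power_add)
  finally show ?thesis .
qed (use assms in \<open>simp add: not_le binomial_eq_0\<close>)

text \<open>Writing the falling factorial as \<open>fact k * (j choose k)\<close> makes it vanish
  for \<open>k > j\<close>, so one formula gives all derivatives of the monomial.\<close>

lemma monomial_derivs:
  "((\<lambda>s. fact k * real (j choose k) * s ^ (j - k)) has_real_derivative
    fact (Suc k) * real (j choose Suc k) * t ^ (j - Suc k)) (at t)"
proof -
  have "real (Suc k * (j choose Suc k)) = real ((j - k) * (j choose k))"
    by (simp only: binomial_absorption binomial_absorb_comp)
  then have "fact k * (real (Suc k) * real (j choose Suc k)) = fact k * (real (j - k) * real (j choose k))"
    by (simp only: of_nat_mult)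
  then have "fact (Suc k) * real (j choose Suc k) = fact k * real (j choose k) * real (j - k)"
    by (simp add: algebra_simps)
  then show ?thesis by (auto intro!: derivative_eq_intros)
qed

text \<open>The derivative bound of order \<open>n\<close> on the monomial carries a factor
  \<open>fact n\<close> that cancels against the remainder formula. For \<open>j < n\<close> the
  binomial is zero, which expresses exactness of interpolation.\<close>

lemma monomial_interp_error:
  assumes z: "inj_on z {..<n}" "z ` {..<n} \<subseteq> {0..L}" and t: "t \<in> {0..L}"
  shows "\<bar>t ^ j - poly (interp_poly z n (\<lambda>s. s ^ j)) t\<bar> \<le> real (j choose n) * L ^ j"
proof (cases "n \<le> j")
  case True
  let ?U = "\<lambda>k s. fact k * real (j choose k) * s ^ (j - k)"
  have "\<bar>?U 0 t - poly ((pderiv ^^ 0) (interp_poly z n (?U 0))) t\<bar>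
      \<le> fact n * real (j choose n) * L ^ (j - n) * (L - 0) ^ (n - 0) / fact (n - 0)"
    by (rule interp_poly_error[where a = 0])
      (use z t in \<open>auto intro!: monomial_derivs mult_left_mono power_mono simp: abs_mult simp del: fact_Suc\<close>)
  also have "\<dots> = real (j choose n) * L ^ j"
    using True by (simp flip: power_add)
  finally show ?thesis by simp
next
  case False
  let ?U = "\<lambda>k s. fact k * real (j choose k) * s ^ (j - k)"
  have "\<bar>?U 0 t - poly ((pderiv ^^ 0) (interp_poly z n (?U 0))) t\<bar> \<le> 0 * (L - 0) ^ (n - 0) / fact (n - 0)"
    by (rule interp_poly_error[where a = 0])
      (use z t False in \<open>auto intro!: monomial_derivs simp: binomial_eq_0 simp del: fact_Suc\<close>)
  then show ?thesis using False by (simp add: binomial_eq_0)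
qed

lemma sum_inverse_fact_le_exp:
  assumes "(y :: real) \<ge> 0"
  shows "(\<Sum>j<n. y ^ (n - j) / fact (n - j)) \<le> exp y"
proof -
  have "(\<Sum>j<n. y ^ (n - j) / fact (n - j)) = (\<Sum>i\<in>{1..n}. y ^ i / fact i)"
    by (rule sum.reindex_bij_witness[of _ "\<lambda>i. n - i" "\<lambda>j. n - j"]) auto
  also have "\<dots> \<le> (\<Sum>i. y ^ i / fact i)"
    using summable_exp[of y] assms by (intro sum_le_suminf) (auto simp: field_simps)
  also have "\<dots> = exp y" by (simp add: exp_def field_simps)
  finally show ?thesis .
qed

section \<open>Geometric bounds for the kriging variance and the kriging mean\<close>

context kriging
begin

text \<open>The kriging weights minimise the variance, so polynomial Lagrange weights bound it from
  above; their error vanishes on all monomials of degree below \<open>n\<close>.\<close>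

lemma V_bound:
  assumes z: "z ` {..<n} \<subseteq> {0..L}" and t: "t \<in> {0..L}" and \<delta>: "\<delta> > 0"
  shows "V \<le> L ^ (2 * n) * (1 + \<delta>) ^ n / fact n * exp (L\<^sup>2 * ((1 + \<delta>) / \<delta>))"
proof -
  \<comment> \<open>Lagrange weights corrected by Gaussian factors, so that each feature error
    becomes \<open>exp (- t^2 / 2)\<close> times the interpolation error of a plain
    monomial.\<close>
  define d where "d k = exp (- t\<^sup>2 / 2) * exp ((z k)\<^sup>2 / 2) * poly (lagrange_poly z n k) t" for k
  define A where "A = L ^ (2 * n) * (1 + \<delta>) ^ n / fact n"
  define y where "y = L\<^sup>2 * ((1 + \<delta>) / \<delta>)"
  \<comment> \<open>The majorant is zero below \<open>n\<close>, and its tail is \<open>A\<close>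
    times the exponential series of \<open>y\<close> shifted by \<open>n\<close>.\<close>
  define B where "B j = (if j < n then 0 else A * (y ^ (j - n) / fact (j - n)))" for j
  have feature_err: "feature_err z n d t j = exp (- t\<^sup>2 / 2) * (t ^ j - poly (interp_poly z n (\<lambda>s. s ^ j)) t)" for j
  proof -
    have "moment z n d j = exp (- t\<^sup>2 / 2) * poly (interp_poly z n (\<lambda>s. s ^ j)) t"
      unfolding moment_def interp_poly_def poly_sum poly_smult sum_distrib_left
      by (intro sum.cong refl) (simp add: d_def flip: exp_add)
    then show ?thesis by (simp add: feature_err_def right_diff_distrib)
  qed
  have le: "(feature_err z n d t j)\<^sup>2 / fact j \<le> B j" for j
  proof -
    have "\<bar>feature_err z n d t j\<bar> \<le> 1 * (real (j choose n) * L ^ j)"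
      unfolding feature_err abs_mult
      by (intro mult_mono monomial_interp_error inj z t) auto
    then have 1: "(feature_err z n d t j)\<^sup>2 \<le> (real (j choose n) * L ^ j)\<^sup>2"
      by (intro abs_le_square_iff[THEN iffD1]) auto
    show ?thesis
    proof (cases "j < n")
      case True
      then show ?thesis using 1 by (simp add: B_def binomial_eq_0)
    next
      case False
      define m where "m = j - n"
      have j: "j = n + m" using False by (simp add: m_def)
      have ch: "real (j choose n) = fact j / (fact n * fact m)"
        using binomial_fact[of n j] j by simp
      have ch': "real (j choose n) \<le> (1 + \<delta>) ^ n * ((1 + \<delta>) / \<delta>) ^ m"
        using binomial_le_geometric[OF \<delta>, of n m] binomial_symmetric[of n j] j by simp
      \<comment> \<open>Of the two binomial factors one is written out to cancel
        \<open>fact j\<close>; the other is bounded geometrically.\<close>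
      have "(real (j choose n) * L ^ j)\<^sup>2 / fact j = real (j choose n) * (L ^ (2 * j) / (fact n * fact m))"
        unfolding power_mult_distrib power2_eq_square[of "real (j choose n)"]
        by (subst (2) ch) (simp add: power_mult mult.commute[of 2])
      also have "\<dots> \<le> (1 + \<delta>) ^ n * ((1 + \<delta>) / \<delta>) ^ m * (L ^ (2 * j) / (fact n * fact m))"
        by (intro mult_right_mono ch') simp
      also have "\<dots> = B j"
        unfolding B_def A_def y_def j
        by (simp add: power_add power_mult_distrib distrib_left del: times_divide_eq_right power_divide)
          (simp add: power_mult power2_eq_square power_mult_distrib mult_ac)
      finally show ?thesis using divide_right_mono[OF 1, of "fact j"] by simp
    qed
  qed
  have "(\<lambda>j. B (j + n)) sums (A * exp y)"
    using sums_mult[OF exp_converges[of y], of A] by (simp add: B_def field_simps)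
  then have "B sums (A * exp y)"
    by (subst sums_zero_iff_shift[symmetric, of n]) (auto simp: B_def)
  then have "1 - 2 * (\<Sum>k<n. d k * gauss_cov t (z k)) + cov_form z n d \<le> A * exp y"
    by (intro sums_le[OF le feature_err_sums])
  then show ?thesis using V_le[of d] by (simp add: A_def y_def)
qed

text \<open>The function need not lie in the reproducing kernel Hilbert space. It has the same kriging mean as its polynomial
  interpolant \<open>p\<close> at the nodes, and \<open>p\<close> does lie in the space, where Cauchy--Schwarz
  applies. The norm of \<open>p\<close> grows like \<open>sqrt (n!) / r\<^sup>n\<close>, which the factor \<open>1 / sqrt (n!)\<close> in the
  standard deviation absorbs.\<close>

lemma mean_error:
  fixes U :: "nat \<Rightarrow> real \<Rightarrow> real"
  assumes z: "z ` {..<n} \<subseteq> {0..L}" and t: "t \<in> {0..L}" and \<delta>: "\<delta> > 0" and r: "r > 0"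
    and U: "\<And>k t. t \<in> {0..L} \<Longrightarrow> (U k has_real_derivative U (Suc k) t) (at t)"
    and M: "\<And>k t. t \<in> {0..L} \<Longrightarrow> \<bar>U k t\<bar> \<le> fact k * M / r ^ k"
  shows "\<bar>exp (- t\<^sup>2 / 2) * U 0 t - (\<Sum>k<n. c k * (exp (- (z k)\<^sup>2 / 2) * U 0 (z k)))\<bar>
    \<le> M * (1 + sqrt ((2 * exp (r\<^sup>2) + 2 * exp (L\<^sup>2 / \<delta>)) * exp (L\<^sup>2 * ((1 + \<delta>) / \<delta>))))
      * (L / r * (1 + \<delta>)) ^ n"
proof -
  define p where "p = interp_poly z n (U 0)"
  define q where "q = L / r"
  define E where "E = exp (L\<^sup>2 * ((1 + \<delta>) / \<delta>))"
  define K where "K = 2 * exp (r\<^sup>2) + 2 * exp (L\<^sup>2 / \<delta>)"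
  have L: "L \<ge> 0" using t by simp
  have q: "q \<ge> 0" using L r by (simp add: q_def)
  have M0: "M \<ge> 0" using M[OF t, of 0] by simp
  \<comment> \<open>The coefficients of \<open>p\<close> are its Taylor coefficients at 0, a point
    of the segment. They are compared with those of \<open>U 0\<close> through the error bound for
    derivatives.\<close>
  have pc: "\<bar>coeff p j\<bar> \<le> M / r ^ j * (1 + real (n choose j) * q ^ (n - j))" if j: "j < n" for j
  proof -
    have "\<bar>U j 0 - poly ((pderiv ^^ j) p) 0\<bar> \<le> (fact n * M / r ^ n) * (L - 0) ^ (n - j) / fact (n - j)"
      unfolding p_def by (rule interp_poly_error) (use U inj z M L j in auto)
    moreover have "poly ((pderiv ^^ j) p) 0 = fact j * coeff p j"
      by (simp add: poly_0_coeff_0 coeff_higher_pderiv pochhammer_fact)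
    moreover have "\<bar>U j 0\<bar> \<le> fact j * M / r ^ j" using M L by simp
    ultimately have "fact j * \<bar>coeff p j\<bar> \<le> fact j * M / r ^ j + (fact n * M / r ^ n) * L ^ (n - j) / fact (n - j)"
      by (simp add: abs_mult[symmetric, of "fact j :: real", simplified])
    also have "(fact n * M / r ^ n) * L ^ (n - j) / fact (n - j)
        = fact j * (M / r ^ j * (real (n choose j) * q ^ (n - j)))"
    proof -
      have "r ^ n = r ^ j * r ^ (n - j)" using j by (simp flip: power_add)
      then show ?thesis using j r by (simp add: binomial_fact q_def power_divide mult_ac)
    qed
    finally have "fact j * \<bar>coeff p j\<bar> \<le> fact j * (M / r ^ j * (1 + real (n choose j) * q ^ (n - j)))"
      by (simp add: algebra_simps)
    then show ?thesis by (rule mult_left_le_imp_le) simp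
  qed
  \<comment> \<open>With \<open>i = n - j\<close> and \<open>C\<close> the binomial,
    \<open>fact j\<close> is \<open>fact n / (C * fact i)\<close>. This removes one power of
    \<open>C\<close> from the square: the first summand keeps \<open>1 / C\<close>, at most 1, and
    the second a single \<open>C\<close>, bounded geometrically. Terms of two exponential series in
    \<open>i\<close> remain.\<close>
  have coeff_term: "fact j * (coeff p j)\<^sup>2 \<le> fact n * M\<^sup>2 / r ^ (2 * n) *
      (2 * ((r\<^sup>2) ^ (n - j) / fact (n - j)) + 2 * (1 + \<delta>) ^ n * ((L\<^sup>2 / \<delta>) ^ (n - j) / fact (n - j)))"
    if j: "j < n" for j
  proof -
    define i where "i = n - j"
    have n: "n = j + i" using j by (simp add: i_def)
    define C where "C = real (n choose j)"
    have C1: "C \<ge> 1" using j by (simp add: C_def Suc_leI)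
    have fj: "fact j = fact n / (C * fact i)" using j by (simp add: C_def binomial_fact i_def)
    have Cle: "C \<le> (1 + \<delta>) ^ n * (1 / \<delta>) ^ i"
      using binomial_le_geometric'[OF \<delta>, of n i] binomial_symmetric[of j n] j by (simp add: C_def i_def)
    have "(coeff p j)\<^sup>2 \<le> (M / r ^ j * (1 + C * q ^ i))\<^sup>2"
      using power_mono[OF pc[OF j], of 2] by (simp add: C_def i_def)
    also have "\<dots> = (M / r ^ j)\<^sup>2 * (1 + C * q ^ i)\<^sup>2" by (rule power_mult_distrib)
    also have "\<dots> \<le> (M / r ^ j)\<^sup>2 * (2 + 2 * C\<^sup>2 * q ^ (2 * i))"
      using sum_squares_bound[of 1 "C * q ^ i"]
      by (intro mult_left_mono) (simp_all add: power2_sum power_mult_distrib power_mult mult.commute[of 2])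
    finally have "fact j * (coeff p j)\<^sup>2 \<le> fact n / (C * fact i) * ((M / r ^ j)\<^sup>2 * (2 + 2 * C\<^sup>2 * q ^ (2 * i)))"
      unfolding fj using C1 by (intro mult_left_mono) auto
    also have "\<dots> = fact n * M\<^sup>2 / r ^ (2 * n) * (2 * (r ^ (2 * i) / (C * fact i)) + 2 * C * ((r * q) ^ (2 * i) / fact i))"
      using C1 r by (simp add: n power_add power_mult_distrib power_divide power_mult distrib_left field_simps power2_eq_square)
    also have "\<dots> \<le> fact n * M\<^sup>2 / r ^ (2 * n) * (2 * (r ^ (2 * i) / (1 * fact i))
        + 2 * ((1 + \<delta>) ^ n * (1 / \<delta>) ^ i) * ((r * q) ^ (2 * i) / fact i))"
      using C1 Cle r q
      by (intro mult_left_mono add_mono mult_right_mono divide_left_mono mult_right_mono) auto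
    also have "r * q = L" using r by (simp add: q_def)
    finally show ?thesis by (simp add: i_def power_mult power_divide mult.assoc)
  qed
  have "(\<Sum>j<n. fact j * (coeff p j)\<^sup>2) \<le> (\<Sum>j<n. fact n * M\<^sup>2 / r ^ (2 * n) *
      (2 * ((r\<^sup>2) ^ (n - j) / fact (n - j)) + 2 * (1 + \<delta>) ^ n * ((L\<^sup>2 / \<delta>) ^ (n - j) / fact (n - j))))"
    by (intro sum_mono coeff_term) simp
  also have "\<dots> = fact n * M\<^sup>2 / r ^ (2 * n) * (2 * (\<Sum>j<n. (r\<^sup>2) ^ (n - j) / fact (n - j))
      + 2 * (1 + \<delta>) ^ n * (\<Sum>j<n. (L\<^sup>2 / \<delta>) ^ (n - j) / fact (n - j)))"
    by (simp only: sum_distrib_left sum.distrib distrib_left mult.assoc)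
  also have "\<dots> \<le> fact n * M\<^sup>2 / r ^ (2 * n) * (2 * exp (r\<^sup>2) * (1 + \<delta>) ^ n + 2 * (1 + \<delta>) ^ n * exp (L\<^sup>2 / \<delta>))"
  proof (intro mult_left_mono add_mono)
    have "(\<Sum>j<n. (r\<^sup>2) ^ (n - j) / fact (n - j)) \<le> exp (r\<^sup>2) * 1" using sum_inverse_fact_le_exp[of "r\<^sup>2" n] by simp
    also have "\<dots> \<le> exp (r\<^sup>2) * (1 + \<delta>) ^ n" using \<delta> by (intro mult_left_mono one_le_power) auto
    finally show "2 * (\<Sum>j<n. (r\<^sup>2) ^ (n - j) / fact (n - j)) \<le> 2 * exp (r\<^sup>2) * (1 + \<delta>) ^ n" by simp
    show "(\<Sum>j<n. (L\<^sup>2 / \<delta>) ^ (n - j) / fact (n - j)) \<le> exp (L\<^sup>2 / \<delta>)"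
      using \<delta> by (intro sum_inverse_fact_le_exp) simp
  qed (use \<delta> r in auto)
  also have "\<dots> = fact n * M\<^sup>2 / r ^ (2 * n) * ((1 + \<delta>) ^ n * K)" by (simp add: K_def algebra_simps)
  finally have S: "(\<Sum>j<n. fact j * (coeff p j)\<^sup>2) \<le> fact n * M\<^sup>2 / r ^ (2 * n) * ((1 + \<delta>) ^ n * K)" .
  let ?l = "\<lambda>g. exp (- t\<^sup>2 / 2) * g t - (\<Sum>k<n. c k * (exp (- (z k)\<^sup>2 / 2) * g (z k)))"
  have "(?l (poly p))\<^sup>2 \<le> V * (\<Sum>j<n. fact j * (coeff p j)\<^sup>2)"
    by (rule feature_err_poly_le) (simp add: p_def degree_interp_poly)
  also have "\<dots> \<le> (L ^ (2 * n) * (1 + \<delta>) ^ n / fact n * E) * (fact n * M\<^sup>2 / r ^ (2 * n) * ((1 + \<delta>) ^ n * K))"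
    unfolding E_def using \<delta> L by (intro mult_mono V_bound z t S) (auto intro: sum_nonneg)
  \<comment> \<open>The factor \<open>fact n\<close> from the norm of \<open>p\<close> cancels the
    one in the variance bound, and each bound contributes one
    \<open>(1 + \<delta>) ^ n\<close>.\<close>
  also have "\<dots> = M\<^sup>2 * (K * E) * ((q * (1 + \<delta>)) ^ n)\<^sup>2"
  proof -
    have "A\<^sup>2 * d / f * E * (f * M\<^sup>2 / B\<^sup>2 * (d * K)) = M\<^sup>2 * (K * E) * (A / B * d)\<^sup>2"
      if "f \<noteq> 0" "B \<noteq> 0" for A B d f :: real
      using that by (simp add: power2_eq_square field_simps)
    from this[of "fact n" "r ^ n" "L ^ n" "(1 + \<delta>) ^ n"] show ?thesis
      using r by (simp add: q_def power_even_eq power_mult_distrib power_divide)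
  qed
  also have "\<dots> = (M * sqrt (K * E) * (q * (1 + \<delta>)) ^ n)\<^sup>2"
    by (simp add: power_mult_distrib K_def E_def)
  finally have "\<bar>?l (poly p)\<bar>\<^sup>2 \<le> (M * sqrt (K * E) * (q * (1 + \<delta>)) ^ n)\<^sup>2"
    by (simp only: power2_abs)
  then have 1: "\<bar>?l (poly p)\<bar> \<le> M * sqrt (K * E) * (q * (1 + \<delta>)) ^ n"
    by (rule power2_le_imp_le) (use M0 q \<delta> in \<open>simp add: K_def E_def\<close>)
  have "\<bar>U 0 t - poly ((pderiv ^^ 0) p) t\<bar> \<le> (fact n * M / r ^ n) * (L - 0) ^ (n - 0) / fact (n - 0)"
    unfolding p_def by (rule interp_poly_error) (use U inj z M t in auto)
  also have "\<dots> = M * q ^ n" by (simp add: q_def power_divide)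
  also have "\<dots> \<le> M * (q * (1 + \<delta>)) ^ n" using M0 q \<delta> by (intro mult_left_mono power_mono) (auto simp: mult_le_cancel_left1)
  finally have "\<bar>U 0 t - poly p t\<bar> \<le> M * (q * (1 + \<delta>)) ^ n" by simp
  then have 2: "\<bar>exp (- t\<^sup>2 / 2) * (U 0 t - poly p t)\<bar> \<le> 1 * (M * (q * (1 + \<delta>)) ^ n)"
    unfolding abs_mult by (intro mult_mono) auto
  \<comment> \<open>\<open>U 0\<close> and \<open>p\<close> agree at the nodes, so their difference
    contributes only at \<open>t\<close>.\<close>
  have "?l (U 0) = exp (- t\<^sup>2 / 2) * (U 0 t - poly p t) + ?l (poly p)"
    by (simp add: p_def poly_interp_poly_nodes inj right_diff_distrib)
  with 1 2 have "\<bar>?l (U 0)\<bar> \<le> M * (q * (1 + \<delta>)) ^ n + M * sqrt (K * E) * (q * (1 + \<delta>)) ^ n"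
    by linarith
  then show ?thesis by (simp add: q_def K_def E_def algebra_simps)
qed

end

section \<open>Improvement under a normal law\<close>

definition std_abs_moment :: real where
  "std_abs_moment = (LINT z|lborel. std_normal_density z * \<bar>z\<bar>)"

lemma std_abs_moment_nonneg: "std_abs_moment \<ge> 0"
  unfolding std_abs_moment_def by (intro integral_nonneg_AE) auto

lemma integral_normal_law:
  assumes "g \<in> borel_measurable borel"
  shows "(\<integral>\<xi>. g \<xi> \<partial>normal_law m v) = (LINT z|lborel. std_normal_density z * g (m + sqrt v * z))"
  unfolding normal_law_def using assms
  by (subst integral_distr) (auto simp: integral_density)

lemma integrable_std_normal_affine:
  "integrable lborel (\<lambda>z. std_normal_density z * (\<alpha> + s * z))"
proof -
  have "integrable lborel (\<lambda>z. \<alpha> * (std_normal_density z * z ^ 0) + s * (std_normal_density z * z ^ 1))"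
    by (intro Bochner_Integration.integrable_add integrable_mult_right integrable_std_normal_moment)
  then show ?thesis by (simp add: algebra_simps)
qed

lemma integral_std_normal_affine:
  "(LINT z|lborel. std_normal_density z * (\<alpha> + s * z)) = \<alpha>"
proof -
  have "(LINT z|lborel. \<alpha> * (std_normal_density z * z ^ (2 * 0)) + s * (std_normal_density z * z ^ (2 * 0 + 1))) = \<alpha>"
    by (subst Bochner_Integration.integral_add)
      (auto simp only: integral_mult_right_zero integral_std_normal_moment_even integral_std_normal_moment_odd
        intro!: integrable_mult_right integrable_std_normal_moment, simp)
  then show ?thesis by (simp add: algebra_simps)
qed

lemma integrable_std_normal_max:
  "integrable lborel (\<lambda>z. std_normal_density z * max 0 (\<alpha> + s * z))"
proof (rule Bochner_Integration.integrable_bound[OF integrable_std_normal_affine])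
  show "AE z in lborel. norm (std_normal_density z * max 0 (\<alpha> + s * z))
      \<le> norm (std_normal_density z * (\<alpha> + s * z))"
    by (intro AE_I2) (auto simp: abs_mult intro!: mult_left_mono)
qed simp

lemma improvement_normal_law:
  "(\<integral>\<xi>. w - min w \<xi> \<partial>normal_law m v)
    = (LINT z|lborel. std_normal_density z * max 0 ((w - m) + (- sqrt v) * z))"
proof -
  have "w - min w (m + sqrt v * z) = max 0 ((w - m) + (- sqrt v) * z)" for z by (auto simp: min_def max_def)
  then show ?thesis by (subst integral_normal_law) auto
qed

text \<open>A positive part dominates its argument, here an affine function of a standard normal
  variable with mean \<open>w - m\<close>.\<close>

lemma improvement_ge: "w - m \<le> (\<integral>\<xi>. w - min w \<xi> \<partial>normal_law m v)"
proof -
  have "w - m = (LINT z|lborel. std_normal_density z * ((w - m) + (- sqrt v) * z))"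
    by (simp only: integral_std_normal_affine)
  also have "\<dots> \<le> (LINT z|lborel. std_normal_density z * max 0 ((w - m) + (- sqrt v) * z))"
    by (intro integral_mono integrable_std_normal_affine integrable_std_normal_max mult_left_mono) auto
  finally show ?thesis by (simp only: improvement_normal_law)
qed

lemma improvement_le:
  assumes "v \<ge> 0"
  shows "(\<integral>\<xi>. w - min w \<xi> \<partial>normal_law m v) \<le> max 0 (w - m) + std_abs_moment * sqrt v"
proof -
  have i: "integrable lborel (\<lambda>z. sqrt v * (std_normal_density z * \<bar>z\<bar>))"
    using integrable_std_normal_moment_abs[of 1] by simp
  \<comment> \<open>The summand \<open>0 * z\<close> brings the constant into the affine shape of
    \<open>integral_std_normal_affine\<close>.\<close>
  have "(LINT z|lborel. std_normal_density z * max 0 ((w - m) + (- sqrt v) * z))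
      \<le> (LINT z|lborel. std_normal_density z * (max 0 (w - m) + 0 * z) + sqrt v * (std_normal_density z * \<bar>z\<bar>))"
  proof (intro integral_mono Bochner_Integration.integrable_add integrable_std_normal_affine integrable_std_normal_max i)
    fix z :: real
    have "- sqrt v * z \<le> sqrt v * \<bar>z\<bar>"
      using assms mult_left_mono[of "- z" "\<bar>z\<bar>" "sqrt v"] by simp
    moreover have "0 \<le> sqrt v * \<bar>z\<bar>" using assms by simp
    ultimately have "max 0 ((w - m) + (- sqrt v) * z) \<le> max 0 (w - m) + sqrt v * \<bar>z\<bar>" by linarith
    from mult_left_mono[OF this, of "std_normal_density z"]
    show "std_normal_density z * max 0 ((w - m) + (- sqrt v) * z) \<le>
        std_normal_density z * (max 0 (w - m) + 0 * z) + sqrt v * (std_normal_density z * \<bar>z\<bar>)"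
      by (simp add: algebra_simps)
  qed
  also have "\<dots> = max 0 (w - m) + sqrt v * std_abs_moment"
    by (subst Bochner_Integration.integral_add[OF integrable_std_normal_affine i])
      (simp only: integral_std_normal_affine integral_mult_right_zero std_abs_moment_def)
  finally show ?thesis by (simp only: improvement_normal_law mult.commute)
qed

lemma improvement_zero:
  assumes "m \<ge> w" shows "(\<integral>\<xi>. w - min w \<xi> \<partial>normal_law m 0) = 0"
  using assms by (simp add: improvement_normal_law max_def)

text \<open>If the integral were zero, the integrand would vanish almost everywhere; but it is
  positive on a half-line, which contains an interval of length 1.\<close>

lemma improvement_pos:
  assumes "v > 0"
  shows "(\<integral>\<xi>. w - min w \<xi> \<partial>normal_law m v) > 0"
proof (rule ccontr)
  let ?g = "\<lambda>z. std_normal_density z * max 0 ((w - m) + (- sqrt v) * z)"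
  have nn: "AE z in lborel. 0 \<le> ?g z" by (intro AE_I2) simp
  assume "\<not> ?thesis"
  then have "integral\<^sup>L lborel ?g = 0"
    using integral_nonneg_AE[OF nn] by (simp only: improvement_normal_law not_less order.antisym)
  then have "AE z in lborel. ?g z = 0"
    using integral_nonneg_eq_0_iff_AE[OF integrable_std_normal_max nn] by simp
  moreover have "?g z \<noteq> 0" if "z < (w - m) / sqrt v" for z
  proof -
    have "max 0 ((w - m) + (- sqrt v) * z) > 0" using that assms by (simp add: field_simps less_max_iff_disj)
    then have "?g z > 0" by (intro mult_pos_pos normal_density_pos) auto
    then show ?thesis by (rule less_imp_neq[THEN not_sym])
  qed
  ultimately have "AE z in lborel. z \<notin> {..<(w - m) / sqrt v}"
    by (auto elim!: eventually_mono)
  then have "emeasure lborel {..<(w - m) / sqrt v} = 0"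
    by (subst (asm) AE_iff_measurable[OF _ refl]) (auto simp: lessThan_def)
  moreover have "emeasure lborel {(w - m) / sqrt v - 1<..<(w - m) / sqrt v} \<le> emeasure lborel {..<(w - m) / sqrt v}"
    by (rule emeasure_mono) auto
  ultimately show False by simp
qed

section \<open>Convergence of the conditional law\<close>

text \<open>Stationarity permits moving the segment to \<open>{0..b - a}\<close>, where the monomial
  estimates about 0 are stated.\<close>

lemma gauss_cov_shift: "gauss_cov (x - a) (y - a) = gauss_cov x y"
  by (simp add: gauss_cov_def)

lemma cov_mat_carrier: "cov_mat xs \<in> carrier_mat (length xs) (length xs)"
  by (simp add: cov_mat_def)

lemma cov_vec_carrier: "cov_vec xs t \<in> carrier_vec (length xs)"
  by (simp add: cov_vec_def)

lemma cov_mat_mult_index: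
  assumes "w \<in> carrier_vec (length xs)" "k < length xs"
  shows "vec_index (cov_mat xs *\<^sub>v w) k = (\<Sum>l<length xs. vec_index w l * gauss_cov (xs ! k) (xs ! l))"
  using assms by (simp add: cov_mat_def scalar_prod_def atLeast0LessThan mult.commute)

text \<open>A nonzero null vector of the matrix would make \<open>cov_form\<close> vanish, which
  positive definiteness excludes. Hence \<open>mat_inverse\<close> returns a \<open>Some\<close> and
  \<open>the\<close> is well-defined.\<close>

lemma cov_inv:
  assumes "distinct xs"
  shows "cov_inv xs \<in> carrier_mat (length xs) (length xs)"
    and "cov_mat xs * cov_inv xs = 1\<^sub>m (length xs)"
proof -
  let ?n = "length xs"
  have "Determinant.det (cov_mat xs) \<noteq> 0"
  proof
    assume "Determinant.det (cov_mat xs) = 0"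
    then obtain v where v: "v \<in> carrier_vec ?n" "v \<noteq> 0\<^sub>v ?n" "cov_mat xs *\<^sub>v v = 0\<^sub>v ?n"
      using det_0_iff_vec_prod_zero_field[OF cov_mat_carrier] by auto
    have "(\<Sum>l<?n. vec_index v l * gauss_cov (xs ! k) (xs ! l)) = 0" if "k < ?n" for k
      using cov_mat_mult_index[OF v(1) that] v(3) that by simp
    then have "cov_form (nth xs) ?n (vec_index v) = 0"
      unfolding cov_form_def by (simp add: mult.assoc flip: sum_distrib_left)
    then have "vec_index v k = 0" if "k < ?n" for k
      using cov_form_pos_def[of "nth xs" ?n "vec_index v" k] inj_on_nth[OF assms] that by auto
    then have "v = 0\<^sub>v ?n" using v(1) by (intro eq_vecI) auto
    with v(2) show False by simp
  qed
  then have "cov_mat xs \<in> Units (ring_mat TYPE(real) ?n ())"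
    by (rule det_non_zero_imp_unit[OF cov_mat_carrier])
  then obtain B where "mat_inverse (cov_mat xs) = Some B"
    using mat_inverse(1)[OF cov_mat_carrier[of xs], where b = "()"] by (cases "mat_inverse (cov_mat xs)") auto
  with mat_inverse(2)[OF cov_mat_carrier this]
  show "cov_inv xs \<in> carrier_mat ?n ?n" "cov_mat xs * cov_inv xs = 1\<^sub>m ?n"
    by (auto simp: cov_inv_def)
qed

lemma cov_inv_solves:
  assumes "distinct xs" "w \<in> carrier_vec (length xs)" "k < length xs"
  shows "(\<Sum>l<length xs. vec_index (cov_inv xs *\<^sub>v w) l * gauss_cov (xs ! k) (xs ! l)) = vec_index w k"
proof -
  have "cov_mat xs *\<^sub>v (cov_inv xs *\<^sub>v w) = w"
    using assoc_mult_mat_vec[OF cov_mat_carrier cov_inv(1)[OF assms(1)] assms(2)] cov_inv(2)[OF assms(1)] assms(2)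
    by simp
  then show ?thesis
    using cov_mat_mult_index[of "cov_inv xs *\<^sub>v w" xs k] cov_inv(1)[OF assms(1)] assms(2,3) by auto
qed

definition kriging_weight :: "real list \<Rightarrow> real \<Rightarrow> nat \<Rightarrow> real" where
  "kriging_weight xs t = vec_index (cov_inv xs *\<^sub>v cov_vec xs t)"

text \<open>The weights are computed from the unshifted points, yet solve the normal equations after
  any shift \<open>a\<close>, since the covariance depends on differences only.\<close>

lemma kriging_nodes:
  assumes "distinct xs"
  shows "kriging (\<lambda>k. xs ! k - a) (length xs) (kriging_weight xs t) (t - a)"
proof
  show "inj_on (\<lambda>k. xs ! k - a) {..<length xs}"
    by (simp add: inj_on_def nth_eq_iff_index_eq[OF assms])
  show "(\<Sum>l<length xs. kriging_weight xs t l * gauss_cov (xs ! k - a) (xs ! l - a)) = gauss_cov (t - a) (xs ! k - a)"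
    if "k < length xs" for k
    using cov_inv_solves[OF assms cov_vec_carrier that, of t] that
    by (simp add: gauss_cov_shift kriging_weight_def cov_vec_def)
qed

lemma cond_var_eq:
  assumes "distinct xs"
  shows "cond_var xs t = kriging.V (\<lambda>k. xs ! k - a) (length xs) (kriging_weight xs t) (t - a)"
  unfolding kriging.V_def[OF kriging_nodes[OF assms]] cond_var_def gauss_cov_shift
  using cov_inv(1)[OF assms]
  by (auto simp: kriging_weight_def scalar_prod_def atLeast0LessThan cov_vec_def mult.commute intro!: sum.cong)

lemma cond_mean_coeffs:
  assumes "distinct xs"
  shows "cond_mean f xs t = (\<Sum>k<length xs. gauss_cov t (xs ! k) *
    vec_index (cov_inv xs *\<^sub>v vec (length xs) (\<lambda>k. f (xs ! k))) k)"
  using cov_inv(1)[OF assms]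
  by (auto simp: cond_mean_def scalar_prod_def atLeast0LessThan cov_vec_def intro!: sum.cong)

text \<open>Symmetry of the covariance matrix moves its inverse from the data to the covariance
  vector, so the mean becomes the linear predictor with the kriging weights.\<close>

lemma cond_mean_weights:
  assumes "distinct xs"
  shows "cond_mean f xs t = (\<Sum>k<length xs. kriging_weight xs t k * f (xs ! k))"
proof -
  let ?n = "length xs" and ?y = "vec (length xs) (\<lambda>k. f (xs ! k))"
  let ?d = "vec_index (cov_inv xs *\<^sub>v ?y)"
  have y: "?y \<in> carrier_vec ?n" by simp
  have "cond_mean f xs t = (\<Sum>k<?n. gauss_cov t (xs ! k) * ?d k)"
    by (rule cond_mean_coeffs[OF assms])
  also have "\<dots> = (\<Sum>k<?n. (\<Sum>l<?n. kriging_weight xs t l * gauss_cov (xs ! k) (xs ! l)) * ?d k)"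
    using kriging.weights[OF kriging_nodes[OF assms, of 0 t]] by simp
  also have "\<dots> = (\<Sum>l<?n. kriging_weight xs t l * (\<Sum>k<?n. ?d k * gauss_cov (xs ! l) (xs ! k)))"
    unfolding sum_distrib_left sum_distrib_right
    by (subst sum.swap) (simp add: mult_ac gauss_cov_commute)
  also have "\<dots> = (\<Sum>l<?n. kriging_weight xs t l * f (xs ! l))"
    using cov_inv_solves[OF assms y] by simp
  finally show ?thesis .
qed

lemma cond_mean_node:
  assumes "distinct xs" "k < length xs"
  shows "cond_mean f xs (xs ! k) = f (xs ! k)"
  unfolding cond_mean_coeffs[OF assms(1)] mult.commute[of "gauss_cov _ _"]
  using cov_inv_solves[OF assms(1) vec_carrier assms(2), of "\<lambda>k. f (xs ! k)"] assms(2) by simp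

lemma cond_var_nonneg: "distinct xs \<Longrightarrow> cond_var xs t \<ge> 0"
  by (metis cond_var_eq kriging.V_nonneg kriging_nodes)

lemma cond_var_node:
  assumes "distinct xs" "k < length xs" shows "cond_var xs (xs ! k) = 0"
  using kriging.V_node[OF kriging_nodes[OF assms(1), of 0 "xs ! k"] assms(2) refl]
  unfolding cond_var_eq[OF assms(1), of "xs ! k" 0] .

lemma cond_var_pos:
  assumes "distinct xs" "t \<notin> set xs" shows "cond_var xs t > 0"
proof -
  have "t - 0 \<notin> (\<lambda>k. xs ! k - 0) ` {..<length xs}" using assms(2) by (auto simp: set_conv_nth)
  then show ?thesis
    using kriging.V_pos[OF kriging_nodes[OF assms(1)]] cond_var_eq[OF assms(1)] by metis
qed

section \<open>Uniform rates for conditional deviation and mean; Cauchy estimates\<close>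

lemma power_fact_le_exp:
  assumes "(y :: real) \<ge> 0" shows "y ^ n / fact n \<le> exp y"
proof (cases n)
  case (Suc n')
  have "y ^ (n - 0) / fact (n - 0) \<le> (\<Sum>j<n. y ^ (n - j) / fact (n - j))"
    by (rule member_le_sum) (use assms Suc in auto)
  then show ?thesis using sum_inverse_fact_le_exp[OF assms, of n] by simp
qed (use assms in simp)

lemma cond_sd_bound:
  assumes xs: "distinct xs" "set xs \<subseteq> {a..b}" and t: "t \<in> {a..b}" and \<rho>: "\<rho> > 0"
  shows "sqrt (cond_var xs t) \<le> sqrt (exp (2 * \<rho>\<^sup>2 + 2 * (b - a)\<^sup>2)) * ((b - a) / \<rho>) ^ length xs"
proof -
  let ?n = "length xs" and ?L = "b - a"
  have nodes: "(\<lambda>k. xs ! k - a) ` {..<?n} \<subseteq> {0..?L}"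
  proof safe
    fix k assume "k < ?n"
    then have "xs ! k \<in> {a..b}" using xs(2) nth_mem by blast
    then show "xs ! k - a \<in> {0..?L}" by simp
  qed
  have "cond_var xs t \<le> ?L ^ (2 * ?n) * (1 + 1) ^ ?n / fact ?n * exp (?L\<^sup>2 * ((1 + 1) / 1))"
    unfolding cond_var_eq[OF xs(1), of t a]
    by (rule kriging.V_bound[OF kriging_nodes[OF xs(1)] nodes]) (use t in auto)
  \<comment> \<open>The variance bound is used with \<delta> = 1. The factor
    \<open>(2 * \<rho>^2) ^ n / fact n\<close> is then bounded by an exponential, trading the
    factorial decay for the geometric rate.\<close>
  also have "\<dots> = (?L / \<rho>) ^ (2 * ?n) * ((2 * \<rho>\<^sup>2) ^ ?n / fact ?n) * exp (2 * ?L\<^sup>2)"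
    using \<rho> by (simp add: power_divide power_mult_distrib power_mult[symmetric])
  also have "\<dots> \<le> (?L / \<rho>) ^ (2 * ?n) * exp (2 * \<rho>\<^sup>2) * exp (2 * ?L\<^sup>2)"
    by (intro mult_right_mono mult_left_mono power_fact_le_exp) (auto simp: power_mult)
  also have "\<dots> = exp (2 * \<rho>\<^sup>2 + 2 * ?L\<^sup>2) * ((?L / \<rho>) ^ ?n)\<^sup>2"
    by (simp add: exp_add power_mult[symmetric] mult_ac)
  finally have "sqrt (cond_var xs t) \<le> sqrt (exp (2 * \<rho>\<^sup>2 + 2 * ?L\<^sup>2) * ((?L / \<rho>) ^ ?n)\<^sup>2)"
    by (rule real_sqrt_le_mono)
  then show ?thesis using t \<rho> by (simp add: real_sqrt_mult)
qed

text \<open>A ball is connected, so one centred in \<open>D\<close> can leave \<open>D\<close> only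
  through the frontier. The strict gain \<open>r < r'\<close> is later spent on the factor
  \<open>1 + \<delta>\<close>.\<close>

lemma cball_subset_of_boundary_dist:
  assumes "boundary_dist_gt S D r" "S \<subseteq> D"
  obtains r' where "r < r'" "\<And>t. t \<in> S \<Longrightarrow> cball t r' \<subseteq> D"
proof -
  obtain r' where r': "r < r'" "frontier D = {} \<or> r' < setdist S (frontier D)"
  proof (cases "frontier D = {}")
    case True then show ?thesis using that[of "r + 1"] by simp
  next
    case False
    then have "r < setdist S (frontier D)" using assms(1) by (simp add: boundary_dist_gt_def)
    then show ?thesis using dense that by blast
  qed
  have "cball t r' \<subseteq> D" if t: "t \<in> S" for t
  proof (cases "r' \<ge> 0")
    case True
    have disj: "cball t r' \<inter> frontier D = {}"
    proof (rule ccontr)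
      assume "cball t r' \<inter> frontier D \<noteq> {}"
      then obtain y where y: "dist t y \<le> r'" "y \<in> frontier D" by auto
      then show False using r'(2) setdist_le_dist[OF t y(2)] by auto
    qed
    show ?thesis
    proof (rule ccontr)
      assume "\<not> ?thesis"
      moreover have "t \<in> cball t r' \<inter> D" using t assms(2) True by auto
      ultimately have "cball t r' \<inter> frontier D \<noteq> {}"
        by (intro connected_Int_frontier convex_connected convex_cball) blast+
      with disj show False by simp
    qed
  qed simp
  with r'(1) that show thesis by blast
qed

lemma holomorphic_real_derivs:
  fixes H :: "complex \<Rightarrow> complex"
  assumes "H holomorphic_on D" "open D" and t: "complex_of_real t \<in> D"
  shows "((\<lambda>s. Re ((deriv ^^ k) H (of_real s))) has_real_derivative Re ((deriv ^^ Suc k) H (of_real t))) (at t)"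
proof -
  have "((deriv ^^ k) H has_field_derivative (deriv ^^ Suc k) H (of_real t)) (at (of_real t))"
    using holomorphic_derivI[OF holomorphic_higher_deriv[OF assms(1,2)] assms(2) t] by simp
  then have "((\<lambda>s. (deriv ^^ k) H (of_real s)) has_vector_derivative (deriv ^^ Suc k) H (of_real t)) (at t)"
    by (rule has_vector_derivative_real_field)
  then have "((\<lambda>s. Re ((deriv ^^ k) H (of_real s))) has_vector_derivative Re ((deriv ^^ Suc k) H (of_real t))) (at t)"
    by (rule bounded_linear.has_vector_derivative[OF bounded_linear_Re])
  then show ?thesis by (simp add: has_real_derivative_iff_has_vector_derivative)
qed

text \<open>Cauchy's inequality, with \<open>M\<close> a bound for the function on the compact
  closed \<open>r\<close>-neighbourhood of \<open>S\<close> and hence common to all centres and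
  orders.\<close>

lemma higher_deriv_uniform_bound:
  fixes H :: "complex \<Rightarrow> complex"
  assumes H: "H holomorphic_on D" and S: "compact S" and sub: "\<And>t. t \<in> S \<Longrightarrow> cball t r \<subseteq> D" and r: "r > 0"
  obtains M where "\<And>k t. t \<in> S \<Longrightarrow> norm ((deriv ^^ k) H t) \<le> fact k * M / r ^ k"
proof -
  define K where "K = {t + y | t y. t \<in> S \<and> y \<in> cball 0 r}"
  have K: "compact K" unfolding K_def by (intro compact_sums S compact_cball)
  have inK: "cball t r \<subseteq> K" if "t \<in> S" for t
  proof
    fix w assume "w \<in> cball t r"
    then have "w = t + (w - t)" "w - t \<in> cball 0 r" by (auto simp: dist_norm norm_minus_commute)
    with that show "w \<in> K" unfolding K_def by blast
  qed
  have "K \<subseteq> D"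
  proof
    fix w assume "w \<in> K"
    then obtain t y where "t \<in> S" "y \<in> cball 0 r" "w = t + y" by (auto simp: K_def)
    then have "w \<in> cball t r" by (simp add: dist_norm)
    then show "w \<in> D" using sub \<open>t \<in> S\<close> by blast
  qed
  then have "continuous_on K H"
    by (intro holomorphic_on_imp_continuous_on holomorphic_on_subset[OF H])
  then have "compact (H ` K)" using K by (rule compact_continuous_image)
  then obtain M where M: "\<And>w. w \<in> K \<Longrightarrow> norm (H w) \<le> M"
    using compact_imp_bounded bounded_iff by (metis imageI)
  have "norm ((deriv ^^ k) H t) \<le> fact k * M / r ^ k" if t: "t \<in> S" for k t
  proof (rule Cauchy_inequality[OF _ _ r])
    have "ball t r \<subseteq> D" using sub[OF t] ball_subset_cball by blast
    then show "H holomorphic_on ball t r" using H holomorphic_on_subset by blast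
    show "continuous_on (cball t r) H"
      using H sub[OF t] holomorphic_on_imp_continuous_on holomorphic_on_subset by blast
    show "norm (H w) \<le> M" if "norm (t - w) = r" for w
      using M inK[OF t] that by (auto simp: dist_norm subset_iff)
  qed
  then show thesis by (rule that)
qed

text \<open>The constant is uniform over all node sets in the segment, which is essential because
  the sampled points depend on \<open>f\<close>.\<close>

lemma cond_mean_bound:
  fixes f :: "real \<Rightarrow> real" and F :: "complex \<Rightarrow> complex"
  assumes D: "open D" "complex_of_real ` {a..b} \<subseteq> D" and F: "F holomorphic_on D"
    and Ff: "\<And>t. t \<in> {a..b} \<Longrightarrow> F (complex_of_real t) = complex_of_real (f t)"
    and dist: "boundary_dist_gt (complex_of_real ` {a..b}) D \<rho>" and \<rho>: "\<rho> > 0"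
  obtains C where "\<And>xs t. distinct xs \<Longrightarrow> set xs \<subseteq> {a..b} \<Longrightarrow> t \<in> {a..b} \<Longrightarrow>
    \<bar>f t - cond_mean f xs t\<bar> \<le> C * ((b - a) / \<rho>) ^ length xs"
proof -
  let ?S = "complex_of_real ` {a..b}"
  obtain r where r: "\<rho> < r" "\<And>t. t \<in> ?S \<Longrightarrow> cball t r \<subseteq> D"
    using cball_subset_of_boundary_dist[OF dist D(2)] by blast
  \<comment> \<open>\<open>F\<close> divided by the Gaussian factor of the features, which is entire
    and without zeros, so \<open>H\<close> is holomorphic where \<open>F\<close> is.\<close>
  define H where "H w = F w * exp ((w - of_real a)\<^sup>2 / 2)" for w
  have H: "H holomorphic_on D" unfolding H_def by (intro holomorphic_intros F) auto
  have S: "compact ?S" by (intro compact_continuous_image continuous_intros) auto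
  have r0: "r > 0" using r(1) \<rho> by simp
  obtain M where M: "\<And>k t. t \<in> ?S \<Longrightarrow> norm ((deriv ^^ k) H t) \<le> fact k * M / r ^ k"
    using higher_deriv_uniform_bound[OF H S r(2) r0] by blast
  define U where "U k s = Re ((deriv ^^ k) H (of_real (s + a)))" for k s
  have U: "(U k has_real_derivative U (Suc k) s) (at s)" if "s \<in> {0..b - a}" for k s
  proof -
    have "complex_of_real (s + a) \<in> ?S" using that by (intro imageI) auto
    then have "complex_of_real (s + a) \<in> D" using D(2) by blast
    then show ?thesis unfolding U_def
      by (subst DERIV_shift[symmetric]) (rule holomorphic_real_derivs[OF H D(1)])
  qed
  have UM: "\<bar>U k s\<bar> \<le> fact k * M / r ^ k" if "s \<in> {0..b - a}" for k s
    unfolding U_def by (rule order.trans[OF abs_Re_le_cmod M], rule imageI) (use that in auto)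
  have U0: "exp (- (t - a)\<^sup>2 / 2) * U 0 (t - a) = f t" if "t \<in> {a..b}" for t
  proof -
    have "H (of_real t) = of_real (f t * exp ((t - a)\<^sup>2 / 2))"
      using Ff[OF that] by (simp add: H_def flip: exp_of_real)
    then have "U 0 (t - a) = f t * exp ((t - a)\<^sup>2 / 2)" by (simp add: U_def)
    then show ?thesis by (simp flip: exp_add)
  qed
  \<comment> \<open>Chosen so that the loss \<open>1 + \<delta>\<close> turns the ratio with the
    larger radius \<open>r\<close> exactly into the ratio with \<rho>.\<close>
  define \<delta> where "\<delta> = r / \<rho> - 1"
  have \<delta>: "\<delta> > 0" and q: "(b - a) / r * (1 + \<delta>) = (b - a) / \<rho>" using r(1) \<rho> by (auto simp: \<delta>_def field_simps)
  define C where "C = M * (1 + sqrt ((2 * exp (r\<^sup>2) + 2 * exp ((b - a)\<^sup>2 / \<delta>)) * exp ((b - a)\<^sup>2 * ((1 + \<delta>) / \<delta>))))"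
  show thesis
  proof (rule that)
    fix xs t assume xs: "distinct xs" "set xs \<subseteq> {a..b}" and t: "t \<in> {a..b}"
    let ?n = "length xs"
    have mem: "xs ! k \<in> {a..b}" if "k < ?n" for k using xs(2) that nth_mem by blast
    then have nodes: "(\<lambda>k. xs ! k - a) ` {..<?n} \<subseteq> {0..b - a}" by auto
    have "\<bar>exp (- (t - a)\<^sup>2 / 2) * U 0 (t - a) - (\<Sum>k<?n. kriging_weight xs t k *
        (exp (- (xs ! k - a)\<^sup>2 / 2) * U 0 (xs ! k - a)))\<bar> \<le> C * ((b - a) / r * (1 + \<delta>)) ^ ?n"
      unfolding C_def
      by (rule kriging.mean_error[OF kriging_nodes[OF xs(1)] nodes _ \<delta> r0 U UM]) (use t in auto)
    then show "\<bar>f t - cond_mean f xs t\<bar> \<le> C * ((b - a) / \<rho>) ^ ?n"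
      unfolding q cond_mean_weights[OF xs(1)] U0[OF t] using U0 mem by simp
  qed
qed

section \<open>The optimization sequence\<close>

lemma EI_sequence_mem:
  assumes "EI_sequence f a b x" "n \<ge> 1" shows "x n \<in> {a..b}"
proof (cases "n = 1")
  case False
  then obtain m where "n = Suc m" "m \<ge> 1" using assms(2) by (cases n) auto
  then show ?thesis using assms(1) by (auto simp: EI_sequence_def is_arg_max_def)
qed (use assms in \<open>simp add: EI_sequence_def\<close>)

lemma EI_sequence_max:
  assumes "EI_sequence f a b x" "n \<ge> 1" "t \<in> {a..b}"
  shows "expected_improvement f x n t \<le> expected_improvement f x n (x (Suc n))"
  using assms by (auto simp: EI_sequence_def is_arg_max_def not_less)

lemma best_value_le:
  assumes "k \<in> {1..n}" shows "best_value f x n \<le> f (x k)"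
  unfolding best_value_def using assms by (intro Min_le) auto

lemma best_value_attained:
  assumes "n \<ge> 1" obtains k where "k \<in> {1..n}" "best_value f x n = f (x k)"
proof -
  have "best_value f x n \<in> (\<lambda>k. f (x k)) ` {1..n}"
    unfolding best_value_def using assms by (intro Min_in) auto
  then show thesis using that by blast
qed

lemma best_value_Suc:
  assumes "n \<ge> 1" shows "best_value f x (Suc n) = min (best_value f x n) (f (x (Suc n)))"
proof -
  have "{1..Suc n} = insert (Suc n) {1..n}" by auto
  then show ?thesis using assms by (simp add: best_value_def min.commute)
qed

lemma EI_sequence_distinct:
  assumes ab: "a < b" and EI: "EI_sequence f a b x"
  shows "distinct (map x [1..<Suc n])"
proof (induction n)
  case (Suc n)
  let ?xs = "map x [1..<Suc n]"
  have nodes: "nodes x n = ?xs" using Suc.IH by (simp add: nodes_def)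
  have EI_eq: "expected_improvement f x n t = (\<integral>\<xi>. best_value f x n - min (best_value f x n) \<xi>
      \<partial>normal_law (cond_mean f ?xs t) (cond_var ?xs t))" for t
    by (simp only: expected_improvement_def cond_law_def nodes)
  have "x (Suc n) \<notin> set ?xs"
  proof
    assume "x (Suc n) \<in> set ?xs"
    then obtain k where k: "k < length ?xs" "?xs ! k = x (Suc n)" by (metis in_set_conv_nth)
    \<comment> \<open>List position \<open>k\<close> holds the sample \<open>x (Suc k)\<close>. Its
      existence also forces \<open>n \<ge> 1\<close>, so that \<open>x (Suc n)\<close> is a
      maximizer and not the arbitrary initial point.\<close>
    then have n: "n \<ge> 1" "Suc k \<in> {1..n}" "x (Suc k) = x (Suc n)" by (auto simp del: upt_Suc)
    have "best_value f x n \<le> f (x (Suc n))" using best_value_le[OF n(2), of f x] n(3) by simp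
    then have 0: "expected_improvement f x n (x (Suc n)) = 0"
      unfolding EI_eq k(2)[symmetric] cond_var_node[OF Suc.IH k(1)] cond_mean_node[OF Suc.IH k(1)]
      by (rule improvement_zero)
    have "infinite ({a..b} - set ?xs)" using ab by (intro Diff_infinite_finite) auto
    then obtain t where t: "t \<in> {a..b}" "t \<notin> set ?xs" by (metis Diff_iff finite.emptyI all_not_in_conv)
    have "expected_improvement f x n t > 0"
      unfolding EI_eq by (intro improvement_pos cond_var_pos Suc.IH t)
    with EI_sequence_max[OF EI n(1) t(1)] 0 show False by simp
  qed
  then show ?case using Suc.IH by simp
qed simp

lemma best_value_rate:
  assumes ab: "a < b" and EI: "EI_sequence f a b x" and \<rho>: "\<rho> > 0"
    and C: "\<And>xs t. distinct xs \<Longrightarrow> set xs \<subseteq> {a..b} \<Longrightarrow> t \<in> {a..b} \<Longrightarrow>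
      \<bar>f t - cond_mean f xs t\<bar> \<le> C * ((b - a) / \<rho>) ^ length xs"
    and t: "t \<in> {a..b}" and n: "n \<ge> 1"
  shows "best_value f x (Suc n) - f t
    \<le> (2 * C + std_abs_moment * sqrt (exp (2 * \<rho>\<^sup>2 + 2 * (b - a)\<^sup>2))) * ((b - a) / \<rho>) ^ n"
proof -
  let ?xs = "map x [1..<Suc n]" and ?w = "best_value f x n" and ?y = "x (Suc n)" and ?q = "((b - a) / \<rho>) ^ n"
  define S where "S = sqrt (exp (2 * \<rho>\<^sup>2 + 2 * (b - a)\<^sup>2))"
  have xs: "distinct ?xs" by (rule EI_sequence_distinct[OF ab EI])
  have sub: "set ?xs \<subseteq> {a..b}" using EI_sequence_mem[OF EI] by auto
  have len: "length ?xs = n" by simp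
  have y: "?y \<in> {a..b}" using EI_sequence_mem[OF EI] by simp
  have nodes: "nodes x n = ?xs" using xs by (simp add: nodes_def del: upt_Suc)
  have EI_eq: "expected_improvement f x n t = (\<integral>\<xi>. ?w - min ?w \<xi>
      \<partial>normal_law (cond_mean f ?xs t) (cond_var ?xs t))" for t
    by (simp only: expected_improvement_def cond_law_def nodes)
  have "?w - cond_mean f ?xs t \<le> expected_improvement f x n t"
    unfolding EI_eq by (rule improvement_ge)
  also have "\<dots> \<le> expected_improvement f x n ?y" by (rule EI_sequence_max[OF EI n t])
  also have "\<dots> \<le> max 0 (?w - cond_mean f ?xs ?y) + std_abs_moment * sqrt (cond_var ?xs ?y)"
    unfolding EI_eq by (rule improvement_le[OF cond_var_nonneg[OF xs]])
  also have "\<dots> \<le> max 0 (?w - cond_mean f ?xs ?y) + std_abs_moment * (S * ?q)"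
    using cond_sd_bound[OF xs sub y \<rho>] unfolding len S_def
    by (intro add_left_mono mult_left_mono std_abs_moment_nonneg)
  finally have "?w - cond_mean f ?xs t \<le> max 0 (?w - cond_mean f ?xs ?y) + std_abs_moment * (S * ?q)" .
  moreover have "\<bar>f t - cond_mean f ?xs t\<bar> \<le> C * ?q" "\<bar>f ?y - cond_mean f ?xs ?y\<bar> \<le> C * ?q"
    using C[OF xs sub t] C[OF xs sub y] unfolding len by auto
  moreover have "best_value f x (Suc n) = ?w - max 0 (?w - f ?y)"
    unfolding best_value_Suc[OF n] by (simp add: min_def max_def)
  \<comment> \<open>One \<open>C * ?q\<close> replaces the conditional mean by \<open>f\<close> at
    \<open>t\<close>, the other at the new sample.\<close>
  ultimately have "best_value f x (Suc n) - f t \<le> 2 * (C * ?q) + std_abs_moment * (S * ?q)"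
    by (auto simp: max_def split: if_splits)
  then show ?thesis by (simp add: S_def algebra_simps)
qed

theorem theorem3:
  fixes f :: "real \<Rightarrow> real" and a b \<rho> :: real and x :: "nat \<Rightarrow> real"
    and D :: "complex set" and F :: "complex \<Rightarrow> complex"
  assumes "a \<le> b"
    and "EI_sequence f a b x"
    and "open D" and "connected D" and "complex_of_real ` {a..b} \<subseteq> D"
    and "F holomorphic_on D"
    and "\<And>t. t \<in> {a..b} \<Longrightarrow> F (complex_of_real t) = complex_of_real (f t)"
    and "boundary_dist_gt (complex_of_real ` {a..b}) D \<rho>"
    and "\<rho> > \<bar>b - a\<bar>"
  shows "\<exists>t\<^sub>0. is_arg_min f (\<lambda>t. t \<in> {a..b}) t\<^sub>0 \<and>
           (\<lambda>n. best_value f x n) \<longlonglongrightarrow> f t\<^sub>0 \<and>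
           (\<lambda>n. best_value f x n - f t\<^sub>0) \<in> O(\<lambda>n. ((b - a) / \<rho>) ^ n)"
proof -
  define q where "q = (b - a) / \<rho>"
  have \<rho>: "\<rho> > 0" and q: "0 \<le> q" "q < 1" using assms(1,9) by (auto simp: q_def)
  have "continuous_on {a..b} (\<lambda>t. Re (F (complex_of_real t)))"
    by (intro continuous_intros continuous_on_compose2[OF holomorphic_on_imp_continuous_on[OF assms(6)]])
      (use assms(5) in auto)
  then have "continuous_on {a..b} f"
    by (rule continuous_on_eq) (simp add: assms(7))
  then obtain t\<^sub>0 where t0: "t\<^sub>0 \<in> {a..b}" "\<And>t. t \<in> {a..b} \<Longrightarrow> f t\<^sub>0 \<le> f t"
    using continuous_attains_inf[of "{a..b}" f] assms(1) by auto
  have lower: "f t\<^sub>0 \<le> best_value f x n" if "n \<ge> 1" for n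
    using best_value_attained[OF that, of f x] t0(2) EI_sequence_mem[OF assms(2)] by (metis atLeastAtMost_iff)
  \<comment> \<open>The bound starts at 2 because \<open>best_value_rate\<close> controls the best
    value one step after an index that is at least 1.\<close>
  obtain K where K: "\<And>n. n \<ge> 2 \<Longrightarrow> best_value f x n - f t\<^sub>0 \<le> K * q ^ n"
  proof (cases "a = b")
    case True
    \<comment> \<open>On a one-point segment samples repeat, but each of them is the minimizer and
      the error is zero.\<close>
    have "best_value f x n - f t\<^sub>0 \<le> 0 * q ^ n" if "n \<ge> 2" for n
    proof -
      from that have "n \<ge> 1" by simp
      from best_value_attained[OF this] obtain k where k: "k \<in> {1..n}" "best_value f x n = f (x k)"
        by blast
      then have "x k \<in> {a..b}" using EI_sequence_mem[OF assms(2)] by simp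
      with k t0(1) True show ?thesis by simp
    qed
    then show thesis by (rule that)
  next
    case False
    then have ab: "a < b" using assms(1) by simp
    then have q0: "q > 0" using \<rho> by (simp add: q_def)
    obtain C where C: "\<And>xs t. distinct xs \<Longrightarrow> set xs \<subseteq> {a..b} \<Longrightarrow> t \<in> {a..b} \<Longrightarrow>
        \<bar>f t - cond_mean f xs t\<bar> \<le> C * ((b - a) / \<rho>) ^ length xs"
      using cond_mean_bound[OF assms(3,5,6,7,8) \<rho>] by blast
    define K' where "K' = 2 * C + std_abs_moment * sqrt (exp (2 * \<rho>\<^sup>2 + 2 * (b - a)\<^sup>2))"
    \<comment> \<open>Dividing by \<open>q\<close> pays for the delay of one step; \<open>q\<close>
      is positive because \<open>a < b\<close>.\<close>
    have "best_value f x n - f t\<^sub>0 \<le> K' / q * q ^ n" if n: "n \<ge> 2" for n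
    proof -
      obtain m where m: "n = Suc m" "m \<ge> 1" using n by (cases n) auto
      have "best_value f x (Suc m) - f t\<^sub>0 \<le> K' * q ^ m"
        unfolding K'_def q_def by (rule best_value_rate[OF ab assms(2) \<rho> C t0(1) m(2)])
      then show ?thesis using q0 m(1) by simp
    qed
    then show thesis by (rule that)
  qed
  have bound: "norm (best_value f x n - f t\<^sub>0) \<le> K * norm (q ^ n)" if "n \<ge> 2" for n
    using K[OF that] lower[of n] that q by simp
  have O: "(\<lambda>n. best_value f x n - f t\<^sub>0) \<in> O(\<lambda>n. q ^ n)"
    by (rule bigoI[of _ K]) (use bound in \<open>auto simp: eventually_sequentially\<close>)
  have "(\<lambda>n. K * norm (q ^ n)) \<longlonglongrightarrow> K * norm (0 :: real)"
    by (intro tendsto_mult_left tendsto_norm LIMSEQ_power_zero) (use q in simp)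
  then have "(\<lambda>n. K * norm (q ^ n)) \<longlonglongrightarrow> 0" by simp
  then have "(\<lambda>n. best_value f x n - f t\<^sub>0) \<longlonglongrightarrow> 0"
    by (rule Lim_null_comparison[rotated]) (use bound in \<open>auto simp: eventually_sequentially\<close>)
  then have "(\<lambda>n. best_value f x n) \<longlonglongrightarrow> f t\<^sub>0" by (rule LIM_zero_cancel)
  moreover have "is_arg_min f (\<lambda>t. t \<in> {a..b}) t\<^sub>0"
    using t0 by (auto simp: is_arg_min_def not_less)
  ultimately show ?thesis using O unfolding q_def by blast
qed

end
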